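(* Let $d,n>1$ be integers with $n\equiv 1 \pmod{2d}$, and let $a$ be an indeterminate. Then, modulo $\Phi_{n}(q)(1-aq^n)(a-q^n)$, \[ \sum_{k=0}^{(n-1)/d}[3dk+1]\frac{(q;q^{2d})_{k}(q^{d-1};q^{d})_{k}(aq,q/a;q^{d})_{k}}{(q^{d};q^{d})_{k}(q^{d+2};q^{2d})_{k}(aq^{2d},q^{2d}/a;q^{2d})_{k}}q^{d(k^{2}+k)/2} \equiv \frac{(q^{d};q^{2d})_{(n-1)/(2d)}}{(q^{d+2};q^{2d})_{(n-1)/(2d)}}[n]\,q^{-(n-1)(d-1)/(2d)}. \]
   Context: For an indeterminate $q$, $(x;q)_k=(1-x)(1-xq)\cdots(1-xq^{k-1})$ (with $(x;q)_0=1$), and $(x_1,\dots,x_m;q)_k=(x_1;q)_k\cdots(x_m;q)_k$. $[m]=(1-q^m)/(1-q)$ is the $q$-integer and $\Phi_n(q)$ is the $n$-th cyclotomic polynomial. A congruence between rational functions in $q$ and $a$ modulo a polynomial $P(q,a)$ means that the difference is $P(q,a)$ times a rational function in $q,a$ whose denominator is coprime to $P(q,a)$. *)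

theory Defs
  imports
    Complex_Main
    "HOL-Computational_Algebra.Computational_Algebra"
    "HOL-Number_Theory.Cong"
begin

subsection \<open>Cyclotomic polynomials\<close>

definition primitive_roots_unity :: "nat \<Rightarrow> complex set" where
  "primitive_roots_unity n = {z. z ^ n = 1 \<and> (\<forall>m. 0 < m \<and> m < n \<longrightarrow> z ^ m \<noteq> 1)}"

text \<open>
  The product over the primitive roots has rational coefficients; the existence and
  uniqueness needed for the description operator are proved below
  (\<open>of_rat_cyclotomic\<close>).
\<close>
definition cyclotomic :: "nat \<Rightarrow> rat poly" where
  "cyclotomic n = (THE p. map_poly of_rat p = (\<Prod>z\<in>primitive_roots_unity n. [:- z, 1:]))"

abbreviation of_rat_poly :: "rat poly \<Rightarrow> complex poly" where
  "of_rat_poly \<equiv> map_poly of_rat"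

lemma of_rat_poly_add: "of_rat_poly (p + q) = of_rat_poly p + of_rat_poly q"
  by (intro poly_eqI) (simp add: coeff_map_poly of_rat_add)

lemma of_rat_poly_diff: "of_rat_poly (p - q) = of_rat_poly p - of_rat_poly q"
  by (intro poly_eqI) (simp add: coeff_map_poly of_rat_diff)

lemma of_rat_poly_mult: "of_rat_poly (p * q) = of_rat_poly p * of_rat_poly q"
  by (intro poly_eqI) (simp add: coeff_map_poly coeff_mult of_rat_sum of_rat_mult)

lemma of_rat_poly_prod: "of_rat_poly (\<Prod>i\<in>A. f i) = (\<Prod>i\<in>A. of_rat_poly (f i))"
  by (induction A rule: infinite_finite_induct) (simp_all add: of_rat_poly_mult)

lemma degree_of_rat_poly: "degree (of_rat_poly p) = degree p"
  by (rule degree_map_poly) auto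

lemma of_rat_poly_eq_0_iff: "of_rat_poly p = 0 \<longleftrightarrow> p = 0"
  by (rule map_poly_eq_0_iff) auto

lemma of_rat_poly_inj: "of_rat_poly p = of_rat_poly q \<longleftrightarrow> p = q"
  using of_rat_poly_eq_0_iff[of "p - q"] by (simp add: of_rat_poly_diff)

lemma prod_roots_unity:
  assumes "n > 0"
  shows "(\<Prod>z | z ^ n = 1. [:- z, 1:]) = (monom 1 n - 1 :: complex poly)"
proof (rule ccontr)
  let ?R = "{z::complex. z ^ n = 1}"
  let ?P = "\<Prod>z\<in>?R. [:- z, 1:]"
  define D where "D = ?P - (monom 1 n - 1)"
  assume "?P \<noteq> monom 1 n - 1"
  then have D0: "D \<noteq> 0" by (simp add: D_def)
  have card: "card ?R = n" by (rule card_roots_unity_eq[OF assms])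
  have fin: "finite ?R" by (rule card_ge_0_finite) (simp add: card assms)
  have degP: "degree ?P = n"
    using card by (subst degree_prod_sum_eq) auto
  have lcP: "lead_coeff ?P = 1"
    by (subst lead_coeff_prod) simp
  have "coeff D n = 0"
    using degP lcP assms by (simp add: D_def)
  moreover have "degree D \<le> n"
    unfolding D_def using degP
    by (intro degree_diff_le) (auto simp: degree_monom_le)
  ultimately have "degree D < n"
    using D0 by (metis le_neq_implies_less leading_coeff_0_iff)
  moreover have "?R \<subseteq> {z. poly D z = 0}"
    using fin by (auto simp: D_def poly_prod poly_monom prod_zero_iff)
  then have "card ?R \<le> degree D"
    by (rule order.trans[OF card_mono[OF poly_roots_finite[OF D0]] card_poly_roots_bound[OF D0]])
  ultimately show False using card by simp
qed

lemma roots_unity_partition: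
  assumes "n > 0"
  shows "{z::complex. z ^ n = 1} = (\<Union>d\<in>{d. d dvd n}. primitive_roots_unity d)"
proof (intro equalityI subsetI)
  fix z :: complex assume "z \<in> {z. z ^ n = 1}"
  then have z: "z ^ n = 1" by simp
  define d where "d = (LEAST m. 0 < m \<and> z ^ m = 1)"
  have d: "0 < d" "z ^ d = 1"
    using LeastI[of "\<lambda>m. 0 < m \<and> z ^ m = 1" n] z assms by (auto simp: d_def)
  have least: "z ^ m \<noteq> 1" if "0 < m" "m < d" for m
    using not_less_Least[of m "\<lambda>m. 0 < m \<and> z ^ m = 1"] that by (auto simp: d_def)
  have "z ^ n = (z ^ d) ^ (n div d) * z ^ (n mod d)"
    by (simp only: power_mult[symmetric] power_add[symmetric] mult_div_mod_eq)
  then have "z ^ (n mod d) = 1" using z d by simp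
  then have "n mod d = 0" using least[of "n mod d"] d by auto
  then have "d dvd n" by auto
  moreover have "z \<in> primitive_roots_unity d"
    using d least by (auto simp: primitive_roots_unity_def)
  ultimately show "z \<in> (\<Union>d\<in>{d. d dvd n}. primitive_roots_unity d)" by blast
next
  fix z assume "z \<in> (\<Union>d\<in>{d. d dvd n}. primitive_roots_unity d)"
  then show "z \<in> {z. z ^ n = 1}"
    by (auto simp: primitive_roots_unity_def power_mult elim!: dvdE)
qed

lemma primitive_roots_unity_disjoint:
  assumes "0 < d" "0 < e" "d \<noteq> e"
  shows "primitive_roots_unity d \<inter> primitive_roots_unity e = {}"
proof -
  have "d < e \<or> e < d" using assms by auto
  then show ?thesis using assms by (auto simp: primitive_roots_unity_def)
qed

lemma prod_primitive_roots_unity: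
  assumes "n > 0"
  shows "(\<Prod>d | d dvd n. \<Prod>z\<in>primitive_roots_unity d. [:- z, 1:]) = monom 1 n - 1"
proof -
  have fin: "finite (primitive_roots_unity d)" if "d dvd n" for d
  proof (rule finite_subset)
    show "primitive_roots_unity d \<subseteq> {z. z ^ n = 1}"
      using roots_unity_partition[OF assms] that by blast
    show "finite {z::complex. z ^ n = 1}"
      by (rule card_ge_0_finite) (simp add: card_roots_unity_eq[OF assms] assms)
  qed
  have "(\<Prod>z\<in>(\<Union>d\<in>{d. d dvd n}. primitive_roots_unity d). [:- z, 1:])
      = (\<Prod>d | d dvd n. \<Prod>z\<in>primitive_roots_unity d. [:- z, 1:])"
    using assms fin
    by (intro prod.UNION_disjoint)
       (auto simp: primitive_roots_unity_disjoint dvd_pos_nat simp del: Int_iff)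
  then show ?thesis
    using roots_unity_partition[OF assms] prod_roots_unity[OF assms] by simp
qed

lemma rational_cofactor:
  assumes B: "B \<noteq> 0" and eq: "of_rat_poly A = of_rat_poly B * C"
  shows "\<exists>Q. of_rat_poly Q = C"
proof
  let ?Q = "A div B" and ?R = "A mod B"
  have "of_rat_poly A = of_rat_poly B * of_rat_poly ?Q + of_rat_poly ?R"
    by (metis mult_div_mod_eq of_rat_poly_add of_rat_poly_mult)
  then have R: "of_rat_poly ?R = of_rat_poly B * (C - of_rat_poly ?Q)"
    using eq by (simp add: algebra_simps)
  show "of_rat_poly ?Q = C"
  proof (rule ccontr)
    assume "of_rat_poly ?Q \<noteq> C"
    then have ne: "C - of_rat_poly ?Q \<noteq> 0" by simp
    have "?R \<noteq> 0"
      using R ne B by (metis mult_eq_0_iff of_rat_poly_eq_0_iff)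
    then have "degree ?R < degree B" using degree_mod_less[OF B, of A] by simp
    moreover have "degree ?R = degree B + degree (C - of_rat_poly ?Q)"
      using degree_mult_eq[of "of_rat_poly B" "C - of_rat_poly ?Q"] R ne B
      by (metis degree_of_rat_poly of_rat_poly_eq_0_iff)
    ultimately show False by simp
  qed
qed

lemma ex_rational_cyclotomic:
  assumes "n > 0"
  shows "\<exists>p. of_rat_poly p = (\<Prod>z\<in>primitive_roots_unity n. [:- z, 1:])"
  using assms
proof (induction n rule: less_induct)
  case (less n)
  let ?C = "\<lambda>d. \<Prod>z\<in>primitive_roots_unity d. [:- z, 1:]"
  let ?S = "{d. d dvd n \<and> d < n}"
  have "\<forall>d\<in>?S. \<exists>p. of_rat_poly p = ?C d"
    using less by (auto intro: dvd_pos_nat)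
  then obtain f where f: "\<And>d. d \<in> ?S \<Longrightarrow> of_rat_poly (f d) = ?C d" by metis
  have S: "{d. d dvd n} = insert n ?S" using less.prems by (auto dest: dvd_imp_le)
  have "of_rat_poly (monom 1 n - 1) = (\<Prod>d | d dvd n. ?C d)"
    using prod_primitive_roots_unity[OF less.prems]
    by (simp add: of_rat_poly_diff map_poly_monom)
  also have "\<dots> = ?C n * (\<Prod>d\<in>?S. ?C d)"
    unfolding S by (subst prod.insert) auto
  also have "(\<Prod>d\<in>?S. ?C d) = of_rat_poly (\<Prod>d\<in>?S. f d)"
    unfolding of_rat_poly_prod by (intro prod.cong) (auto simp: f)
  finally have eq: "of_rat_poly (monom 1 n - 1) = of_rat_poly (\<Prod>d\<in>?S. f d) * ?C n"
    by (simp add: mult.commute)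
  have "coeff (monom 1 n - 1 :: rat poly) n \<noteq> 0" using less.prems by simp
  then have "monom 1 n - 1 \<noteq> (0 :: rat poly)" by fastforce
  then have "(\<Prod>d\<in>?S. f d) \<noteq> 0"
    using eq by (metis mult_zero_left of_rat_poly_eq_0_iff)
  then show ?case using rational_cofactor[OF _ eq] by blast
qed

lemma of_rat_cyclotomic:
  assumes "n > 0"
  shows "map_poly of_rat (cyclotomic n) = (\<Prod>z\<in>primitive_roots_unity n. [:- z, 1:])"
  unfolding cyclotomic_def
proof (rule theI')
  show "\<exists>!p. of_rat_poly p = (\<Prod>z\<in>primitive_roots_unity n. [:- z, 1:])"
  proof (rule ex_ex1I[OF ex_rational_cyclotomic[OF assms]])
    fix p r
    assume "of_rat_poly p = (\<Prod>z\<in>primitive_roots_unity n. [:- z, 1:])"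
      and "of_rat_poly r = (\<Prod>z\<in>primitive_roots_unity n. [:- z, 1:])"
    then have "of_rat_poly p = of_rat_poly r" by simp
    then show "p = r" by (rule iffD1[OF of_rat_poly_inj])
  qed
qed


subsection \<open>\<open>q\<close>-shifted factorials and \<open>q\<close>-integers\<close>

definition qpoch :: "'a::comm_ring_1 \<Rightarrow> 'a \<Rightarrow> nat \<Rightarrow> 'a" where
  "qpoch x q k = (\<Prod>i<k. 1 - x * q ^ i)"

definition qint :: "'a::field \<Rightarrow> nat \<Rightarrow> 'a" where
  "qint q m = (1 - q ^ m) / (1 - q)"


subsection \<open>Rational functions in \<open>q\<close> and \<open>a\<close>\<close>

text \<open>
  The polynomial ring in two indeterminates is modelled as \<open>\<rat>[q][a]\<close>: the inner
  variable is \<open>q\<close>, the outer one is \<open>a\<close>.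
\<close>
type_synonym poly_qa = "rat poly poly"
type_synonym ratfun_qa = "rat poly poly fract"

definition poly_q :: poly_qa where
  "poly_q = [:[:0, 1:]:]"

definition poly_a :: poly_qa where
  "poly_a = [:0, 1:]"

definition ratfun_q :: ratfun_qa where
  "ratfun_q = to_fract poly_q"

definition ratfun_a :: ratfun_qa where
  "ratfun_a = to_fract poly_a"

text \<open>The condition \<open>D \<noteq> 0\<close> is needed because \<open>Fract N 0 = 0\<close>.\<close>
definition ratfun_cong :: "ratfun_qa \<Rightarrow> ratfun_qa \<Rightarrow> poly_qa \<Rightarrow> bool" where
  "ratfun_cong f g P \<longleftrightarrow>
     (\<exists>N D. D \<noteq> 0 \<and> coprime D P \<and> f - g = to_fract P * Fraction_Field.Fract N D)"

end

theory Submission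
  imports Defs "HOL-Computational_Algebra.Field_as_Ring"
begin

text \<open>
  Put \<open>p = q^d\<close>, \<open>e = p / q\<close> and \<open>n = 2 d m + 1\<close>. Up to the factor \<open>1 / (1 - q)\<close> the summand is the term of
  the Gasper--Rahman quadratic series with parameters \<open>b = q / s\<close>, \<open>c = q s\<close>, \<open>e\<close>, where \<open>s\<close> is
  \<open>a\<close> or \<open>1 / a\<close>, and \<open>A = b c e / p = q\<close>. A Gosper-type certificate relates the truncated series to
  the one with \<open>c\<close> replaced by \<open>c p\<^sup>2\<close> (hence \<open>A\<close> by \<open>A p\<^sup>2\<close>), with an explicit boundary term.
  Iterating \<open>m\<close> times is an exact identity in \<open>\<rat>(q, a)\<close>. All boundary terms contain the factor
  \<open>1 - A p\<^sup>2\<^sup>m = 1 - q^n\<close> and the factor \<open>1 - c p\<^sup>2\<^sup>m = 1 - s q^n\<close>. Modulo \<open>\<Phi>\<^sub>n(q)\<close> the shifted series vanishes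
  as well, since \<open>A p\<^sup>2\<^sup>m\<close> becomes \<open>1\<close>; modulo \<open>1 - s q^n\<close> only its constant term survives,
  and the accumulated ratio is the product on the right-hand side.
\<close>

section \<open>A contiguous relation for the quadratic series\<close>

lemma qpoch_0 [simp]: "qpoch x q 0 = 1"
  by (simp add: qpoch_def)

lemma qpoch_Suc: "qpoch x q (Suc k) = qpoch x q k * (1 - x * q ^ k)"
  by (simp add: qpoch_def)

lemma qpoch_Suc_shift: "qpoch x q (Suc k) = (1 - x) * qpoch (x * q) q k"
  by (induction k) (simp_all add: qpoch_Suc mult_ac)

text \<open>With \<open>A = b * c * e / p\<close> the quadratic denominator parameters are
  \<open>A * p^2 / b\<close>, \<open>A * p^2 / c\<close> and \<open>A * p^2 / e\<close>, so the term
  is symmetric in \<open>b\<close>, \<open>c\<close>, \<open>e\<close>. It is not normalised by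
  \<open>1 - A\<close>, since that factor is no unit modulo the cyclotomic polynomial after the last
  shift.\<close>

definition quad_term :: "'a::field \<Rightarrow> 'a \<Rightarrow> 'a \<Rightarrow> 'a \<Rightarrow> nat \<Rightarrow> 'a" where
  "quad_term b c e p k =
     (1 - b * c * e / p * p ^ (3 * k))
     * (qpoch (b * c * e / p) (p\<^sup>2) k * qpoch b p k * qpoch c p k * qpoch e p k)
     / (qpoch p p k * qpoch (c * e * p) (p\<^sup>2) k * qpoch (b * e * p) (p\<^sup>2) k
        * qpoch (b * c * p) (p\<^sup>2) k)
     * p ^ (k * (k + 1) div 2)"

definition quad_ratio :: "'a::field \<Rightarrow> 'a \<Rightarrow> 'a \<Rightarrow> 'a \<Rightarrow> 'a" where
  "quad_ratio b c e p = (1 - b * c * e / p) * (1 - c * p) / ((1 - c * e * p) * (1 - b * c * p))"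

text \<open>An antidifference in the summation index: its increments make up the gap between the
  term for \<open>c\<close> and \<open>quad_ratio\<close> times the term for
  \<open>c * p^2\<close>.\<close>

definition quad_cert :: "'a::field \<Rightarrow> 'a \<Rightarrow> 'a \<Rightarrow> 'a \<Rightarrow> nat \<Rightarrow> 'a" where
  "quad_cert b c e p N =
     c * p ^ Suc N
     * (qpoch (b * c * e / p) (p\<^sup>2) (Suc N) * qpoch b p (Suc N) * qpoch e p (Suc N)
        * qpoch (c * p) p N)
     / (qpoch p p N * qpoch (c * e * p) (p\<^sup>2) (Suc N) * qpoch (b * c * p) (p\<^sup>2) (Suc N)
        * qpoch (b * e * p) (p\<^sup>2) N)
     * p ^ (N * (N + 1) div 2)"

text \<open>The term relation after cancelling the common factor, with \<open>y = p^k\<close> and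
  \<open>p * y = p^(k+1)\<close>. Each \<open>A\<close> comes with a factor \<open>p\<close>, so
  \<open>A * p = b * c * e\<close> eliminates it and expansion settles the rest.\<close>

lemma quad_polynomial_identity:
  fixes A b c e p y :: "'a::comm_ring_1"
  assumes "A * p = b * c * e"
  shows "(1 - A * (p * y) ^ 3) * (1 - c) * (1 - c * e * p * (p * y)\<^sup>2) * (1 - b * c * p * (p * y)\<^sup>2)
    = (1 - A * p\<^sup>2 * (p * y) ^ 3) * (1 - A * (p * y)\<^sup>2) * (1 - c * (p * y)) * (1 - c * p * (p * y))
      + c * p * (p * y) * (1 - A * (p * y)\<^sup>2) * (1 - b * (p * y)) * (1 - e * (p * y)) * (1 - c * (p * y))
      - c * (1 - p * y) * (1 - c * e * p * (p * y)\<^sup>2) * (1 - b * c * p * (p * y)\<^sup>2)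
        * (1 - b * e * p * y\<^sup>2)"
proof -
  have "A * (p * y) ^ 3 = b * c * e * p\<^sup>2 * y ^ 3" "A * (p * y)\<^sup>2 = b * c * e * p * y\<^sup>2"
    "A * p\<^sup>2 * (p * y) ^ 3 = b * c * e * p ^ 4 * y ^ 3"
    unfolding assms[symmetric]
    by (simp_all add: power_mult_distrib power2_eq_square power3_eq_cube
        power4_eq_xxxx mult_ac)
  then show ?thesis
    by (simp only:) (simp add: algebra_simps power2_eq_square power3_eq_cube power4_eq_xxxx)
qed

text \<open>All four quantities are polynomial multiples of one product, and cancelling it leaves
  \<open>quad_polynomial_identity\<close>. Two of the denominators run to \<open>Suc (Suc k)\<close>
  because replacing \<open>c\<close> by \<open>c * p^2\<close> drops their first factor and appends
  one at the end.\<close>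

lemma quad_term_step:
  fixes b c e p :: "'a::field"
  assumes p: "p \<noteq> 0"
    and nz: "qpoch p p (Suc k) \<noteq> 0" "qpoch (b * e * p) (p\<^sup>2) (Suc k) \<noteq> 0"
      "qpoch (c * e * p) (p\<^sup>2) (Suc (Suc k)) \<noteq> 0" "qpoch (b * c * p) (p\<^sup>2) (Suc (Suc k)) \<noteq> 0"
  shows "quad_term b c e p (Suc k)
    = quad_ratio b c e p * quad_term b (c * p\<^sup>2) e p (Suc k) + quad_cert b c e p (Suc k) - quad_cert b c e p k"
proof -
  define A where "A = b * c * e / p"
  have A: "A * p = b * c * e" using p by (simp add: A_def)
  define y where "y = p ^ k"
  define x where "x = p * y"
  define T where "T = p ^ (k * (k + 1) div 2)"
  define a' where "a' = qpoch A (p\<^sup>2) (Suc k)"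
  define b' where "b' = qpoch b p (Suc k)"
  define e' where "e' = qpoch e p (Suc k)"
  define c' where "c' = qpoch (c * p) p k"
  define p' where "p' = qpoch p p k"
  define B' where "B' = qpoch (c * e * p) (p\<^sup>2) (Suc k)"
  define E' where "E' = qpoch (b * c * p) (p\<^sup>2) (Suc k)"
  define C' where "C' = qpoch (b * e * p) (p\<^sup>2) k"
  have px: "p ^ Suc k = x" by (simp add: x_def y_def)
  have px2: "(p\<^sup>2) ^ Suc k = x\<^sup>2" unfolding px[symmetric] by (simp only: power_mult[symmetric] mult.commute)
  have px3: "p ^ (3 * Suc k) = x ^ 3" unfolding px[symmetric] by (simp only: power_mult[symmetric] mult.commute)
  have py2: "(p\<^sup>2) ^ k = y\<^sup>2" unfolding y_def by (simp only: power_mult[symmetric] mult.commute)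
  have tri: "Suc k * (Suc k + 1) div 2 = k * (k + 1) div 2 + Suc k"
  proof -
    have "Suc k * (Suc k + 1) = k * (k + 1) + Suc k * 2" by simp
    then show ?thesis by (metis div_mult_self1 zero_neq_numeral add.commute)
  qed
  have T: "p ^ (Suc k * (Suc k + 1) div 2) = T * x"
    unfolding tri T_def by (simp only: power_add px)
  define dx where "dx = 1 - x"
  define dB where "dB = 1 - c * e * p * x\<^sup>2"
  define dE where "dE = 1 - b * c * p * x\<^sup>2"
  define dC where "dC = 1 - b * e * p * y\<^sup>2"
  have P: "qpoch p p (Suc k) = p' * dx" by (simp add: qpoch_Suc p'_def dx_def x_def y_def)
  have C: "qpoch (b * e * p) (p\<^sup>2) (Suc k) = C' * dC"
    by (simp only: qpoch_Suc C'_def dC_def py2)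
  have B: "qpoch (c * e * p) (p\<^sup>2) (Suc (Suc k)) = B' * dB"
    by (simp only: qpoch_Suc[of _ _ "Suc k"] B'_def dB_def px2)
  have E: "qpoch (b * c * p) (p\<^sup>2) (Suc (Suc k)) = E' * dE"
    by (simp only: qpoch_Suc[of _ _ "Suc k"] E'_def dE_def px2)
  have nz': "p' \<noteq> 0" "dx \<noteq> 0" "C' \<noteq> 0" "dC \<noteq> 0" "B' \<noteq> 0" "dB \<noteq> 0" "E' \<noteq> 0" "dE \<noteq> 0"
    using nz unfolding P C B E by auto
  \<comment> \<open>A common denominator for all four quantities; \<open>dB\<close> and
    \<open>dE\<close> are the factors appended by the shift of \<open>c\<close>.\<close>
  define W where "W = a' * b' * e' * c' * T * x / (p' * dx * (B' * dB) * (E' * dE) * (C' * dC))"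
  have c_split: "qpoch c p (Suc k) = (1 - c) * c'"
    by (simp add: qpoch_Suc_shift c'_def)
  have term1: "quad_term b c e p (Suc k) = W * ((1 - A * x ^ 3) * (1 - c) * dB * dE)"
    unfolding quad_term_def A_def[symmetric] px3 T P C c_split B'_def[symmetric] E'_def[symmetric]
      a'_def[symmetric] b'_def[symmetric] e'_def[symmetric] W_def
    using nz' by (simp add: divide_simps)
  have A2: "b * (c * p\<^sup>2) * e / p = A * p\<^sup>2" by (simp add: A_def)
  have B2: "c * p\<^sup>2 * e * p = c * e * p * p\<^sup>2" "b * (c * p\<^sup>2) * p = b * c * p * p\<^sup>2"
    by simp_all
  \<comment> \<open>The factors of \<open>quad_ratio\<close> complete the shifted factorials:
    \<open>(1 - x) * qpoch (x * q) q k\<close> is \<open>qpoch x q (Suc k)\<close>, which brings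
    everything back to the unshifted parameters.\<close>
  have rA: "(1 - A) * qpoch (A * p\<^sup>2) (p\<^sup>2) (Suc k) = a' * (1 - A * x\<^sup>2)"
    by (simp only: qpoch_Suc_shift[symmetric] qpoch_Suc[of _ _ "Suc k"] a'_def px2)
  have rc: "(1 - c * p) * qpoch (c * p\<^sup>2) p (Suc k) = c' * (1 - c * x) * (1 - c * p * x)"
  proof -
    have "(1 - c * p) * qpoch (c * p * p) p (Suc k) = qpoch (c * p) p (Suc (Suc k))"
      by (simp only: qpoch_Suc_shift)
    also have "\<dots> = c' * (1 - c * x) * (1 - c * p * x)"
      by (simp add: qpoch_Suc c'_def x_def y_def mult_ac)
    finally show ?thesis by (simp add: power2_eq_square mult_ac)
  qed
  have rB: "(1 - c * e * p) * qpoch (c * e * p * p\<^sup>2) (p\<^sup>2) (Suc k) = B' * dB"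
    by (simp only: qpoch_Suc_shift[symmetric] B)
  have rE: "(1 - b * c * p) * qpoch (b * c * p * p\<^sup>2) (p\<^sup>2) (Suc k) = E' * dE"
    by (simp only: qpoch_Suc_shift[symmetric] E)
  have "quad_ratio b c e p * quad_term b (c * p\<^sup>2) e p (Suc k)
    = (1 - A * p\<^sup>2 * x ^ 3) * (((1 - A) * qpoch (A * p\<^sup>2) (p\<^sup>2) (Suc k)) * b'
        * ((1 - c * p) * qpoch (c * p\<^sup>2) p (Suc k)) * e')
      / (p' * dx * ((1 - c * e * p) * qpoch (c * e * p * p\<^sup>2) (p\<^sup>2) (Suc k)) * (C' * dC)
        * ((1 - b * c * p) * qpoch (b * c * p * p\<^sup>2) (p\<^sup>2) (Suc k))) * (T * x)"
    unfolding quad_ratio_def quad_term_def A2 B2 A_def[symmetric] px3 T P C b'_def[symmetric] e'_def[symmetric]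
    by (simp add: mult_ac)
  also have "\<dots> = W * ((1 - A * p\<^sup>2 * x ^ 3) * (1 - A * x\<^sup>2) * (1 - c * x) * (1 - c * p * x))"
    unfolding rA rc rB rE W_def by (simp add: mult_ac)
  finally have term2: "quad_ratio b c e p * quad_term b (c * p\<^sup>2) e p (Suc k) = \<dots>" .
  have step: "qpoch A (p\<^sup>2) (Suc (Suc k)) = a' * (1 - A * x\<^sup>2)"
    "qpoch b p (Suc (Suc k)) = b' * (1 - b * x)" "qpoch e p (Suc (Suc k)) = e' * (1 - e * x)"
    by (simp_all only: qpoch_Suc[of _ _ "Suc k"] a'_def b'_def e'_def px px2)
  have step_c: "qpoch (c * p) p (Suc k) = c' * (1 - c * x)"
    by (simp add: qpoch_Suc c'_def x_def y_def mult_ac)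
  have pSS: "p ^ Suc (Suc k) = p * x" by (simp add: x_def y_def)
  have term3: "quad_cert b c e p (Suc k)
    = W * (c * p * x * (1 - A * x\<^sup>2) * (1 - b * x) * (1 - e * x) * (1 - c * x))"
    unfolding quad_cert_def A_def[symmetric] step step_c P B E C T W_def pSS
    by (simp add: mult_ac)
  have term4: "quad_cert b c e p k = W * (c * dx * dB * dE * dC)"
    unfolding quad_cert_def A_def[symmetric] px a'_def[symmetric] b'_def[symmetric] e'_def[symmetric]
      c'_def[symmetric] p'_def[symmetric] B'_def[symmetric] E'_def[symmetric] C'_def[symmetric]
      T_def[symmetric] W_def
    using nz' by (simp add: divide_simps)
  show ?thesis
    unfolding term1 term2 term3 term4
    using quad_polynomial_identity[OF A, of y]
    unfolding x_def[symmetric] dB_def[symmetric] dE_def[symmetric] dC_def[symmetric] dx_def[symmetric]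
    by (metis distrib_left right_diff_distrib)
qed

text \<open>Telescoping of \<open>quad_term_step\<close>; only the upper boundary term
  remains.\<close>

lemma quad_sum_contiguous:
  fixes b c e p :: "'a::field"
  assumes p: "p \<noteq> 0"
    and "qpoch p p N \<noteq> 0" "qpoch (b * e * p) (p\<^sup>2) N \<noteq> 0"
      "qpoch (c * e * p) (p\<^sup>2) (Suc N) \<noteq> 0" "qpoch (b * c * p) (p\<^sup>2) (Suc N) \<noteq> 0"
  shows "(\<Sum>k\<le>N. quad_term b c e p k)
    = quad_ratio b c e p * (\<Sum>k\<le>N. quad_term b (c * p\<^sup>2) e p k) + quad_cert b c e p N"
  using assms(2-)
proof (induction N)
  case 0
  define A where "A = b * c * e / p"
  have A: "A * p = b * c * e" using p by (simp add: A_def)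
  have A2: "b * (c * p\<^sup>2) * e / p = A * p\<^sup>2" by (simp add: A_def)
  have nz: "1 - c * e * p \<noteq> 0" "1 - b * c * p \<noteq> 0" using 0 by (simp_all add: qpoch_Suc)
  \<comment> \<open>The relation at index \<open>0\<close>, denominators cleared; there is no
    earlier certificate value to subtract.\<close>
  have "(1 - A) * ((1 - c * e * p) * (1 - b * c * p))
      = (1 - A) * (1 - c * p) * (1 - A * p\<^sup>2) + c * p * ((1 - A) * (1 - b) * (1 - e))"
    using A by algebra
  then have "1 - A = (1 - A) * (1 - c * p) / ((1 - c * e * p) * (1 - b * c * p)) * (1 - A * p\<^sup>2)
      + c * p * ((1 - A) * (1 - b) * (1 - e)) / ((1 - c * e * p) * (1 - b * c * p))"
    using nz by (simp add: nonzero_eq_divide_eq add_divide_distrib[symmetric])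
  then show ?case
    unfolding quad_term_def quad_ratio_def quad_cert_def A2 A_def[symmetric]
    by (simp add: qpoch_Suc)
next
  case (Suc N)
  have nz: "qpoch p p N \<noteq> 0" "qpoch (b * e * p) (p\<^sup>2) N \<noteq> 0"
      "qpoch (c * e * p) (p\<^sup>2) (Suc N) \<noteq> 0" "qpoch (b * c * p) (p\<^sup>2) (Suc N) \<noteq> 0"
    using Suc.prems by (auto simp: qpoch_Suc)
  show ?case
    using Suc.IH[OF nz] quad_term_step[OF p Suc.prems] by (simp add: distrib_left)
qed

section \<open>Rational functions whose denominator is coprime to the modulus\<close>

text \<open>The localisation of the polynomial ring at the polynomials coprime to \<open>P\<close>:
  the functions by which a congruence modulo \<open>P\<close> may be multiplied. Polynomials in two
  variables have no Bezout identity, so coprime elements become invertible only after passing to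
  these fractions.\<close>

definition loc :: "poly_qa \<Rightarrow> ratfun_qa set" where
  "loc P = {x. \<exists>N D. D \<noteq> 0 \<and> coprime D P \<and> x = to_fract N / to_fract D}"

definition loc_unit :: "poly_qa \<Rightarrow> ratfun_qa \<Rightarrow> bool" where
  "loc_unit P x \<longleftrightarrow> x \<noteq> 0 \<and> x \<in> loc P \<and> inverse x \<in> loc P"

lemma ratfun_cong_iff: "ratfun_cong f g P \<longleftrightarrow> (\<exists>z\<in>loc P. f - g = to_fract P * z)"
  unfolding ratfun_cong_def loc_def Fract_conv_to_fract by blast

lemma loc_to_fract: "to_fract r \<in> loc P"
  unfolding loc_def mem_Collect_eq by (intro exI[of _ r] exI[of _ 1]) simp

lemma loc_0 [simp]: "0 \<in> loc P" and loc_1 [simp]: "1 \<in> loc P"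
  using loc_to_fract[of 0 P] loc_to_fract[of 1 P] by simp_all

lemma loc_add:
  assumes "x \<in> loc P" "y \<in> loc P"
  shows "x + y \<in> loc P"
proof -
  obtain N D N' D' where *: "D \<noteq> 0" "coprime D P" "x = to_fract N / to_fract D"
      "D' \<noteq> 0" "coprime D' P" "y = to_fract N' / to_fract D'"
    using assms unfolding loc_def by blast
  have "x + y = to_fract (N * D' + N' * D) / to_fract (D * D')"
    using * by (simp add: field_simps)
  moreover have "D * D' \<noteq> 0" "coprime (D * D') P" using * by simp_all
  ultimately show ?thesis unfolding loc_def by blast
qed

lemma loc_mult:
  assumes "x \<in> loc P" "y \<in> loc P"
  shows "x * y \<in> loc P"
proof -
  obtain N D N' D' where *: "D \<noteq> 0" "coprime D P" "x = to_fract N / to_fract D"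
      "D' \<noteq> 0" "coprime D' P" "y = to_fract N' / to_fract D'"
    using assms unfolding loc_def by blast
  have "x * y = to_fract (N * N') / to_fract (D * D')"
    using * by simp
  moreover have "D * D' \<noteq> 0" "coprime (D * D') P" using * by simp_all
  ultimately show ?thesis unfolding loc_def by blast
qed

lemma loc_uminus: "x \<in> loc P \<Longrightarrow> - x \<in> loc P"
  using loc_mult[OF loc_to_fract[of "-1"], of x P] by simp

lemma loc_diff: "x \<in> loc P \<Longrightarrow> y \<in> loc P \<Longrightarrow> x - y \<in> loc P"
  using loc_add[OF _ loc_uminus] by fastforce

lemma loc_power: "x \<in> loc P \<Longrightarrow> x ^ k \<in> loc P"
  by (induction k) (simp_all add: loc_mult)

lemma loc_prod: "(\<And>i. i \<in> I \<Longrightarrow> f i \<in> loc P) \<Longrightarrow> prod f I \<in> loc P"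
  by (induction I rule: infinite_finite_induct) (simp_all add: loc_mult)

lemma loc_divide: "x \<in> loc P \<Longrightarrow> loc_unit P y \<Longrightarrow> x / y \<in> loc P"
  unfolding loc_unit_def divide_inverse by (simp add: loc_mult)

lemma loc_qpoch: "x \<in> loc P \<Longrightarrow> y \<in> loc P \<Longrightarrow> qpoch x y k \<in> loc P"
  unfolding qpoch_def by (intro loc_prod loc_diff loc_mult loc_power loc_1)

lemma loc_unitD: "loc_unit P x \<Longrightarrow> x \<in> loc P" "loc_unit P x \<Longrightarrow> x \<noteq> 0"
  unfolding loc_unit_def by simp_all

lemma loc_unit_to_fract:
  assumes "r \<noteq> 0" "coprime r P"
  shows "loc_unit P (to_fract r)"
proof -
  have "inverse (to_fract r) = to_fract 1 / to_fract r" by (simp add: divide_inverse)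
  then have "inverse (to_fract r) \<in> loc P" unfolding loc_def using assms by blast
  then show ?thesis using assms by (simp add: loc_unit_def loc_to_fract)
qed

lemma loc_unit_1 [simp]: "loc_unit P 1"
  by (simp add: loc_unit_def)

lemma loc_unit_mult: "loc_unit P x \<Longrightarrow> loc_unit P y \<Longrightarrow> loc_unit P (x * y)"
  unfolding loc_unit_def by (simp add: loc_mult)

lemma loc_unit_inverse: "loc_unit P x \<Longrightarrow> loc_unit P (inverse x)"
  unfolding loc_unit_def by simp

lemma loc_unit_divide: "loc_unit P x \<Longrightarrow> loc_unit P y \<Longrightarrow> loc_unit P (x / y)"
  unfolding divide_inverse by (intro loc_unit_mult loc_unit_inverse)

lemma loc_unit_power: "loc_unit P x \<Longrightarrow> loc_unit P (x ^ k)"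
  by (induction k) (simp_all add: loc_unit_mult)

lemma loc_unit_qpoch: "(\<And>i. i < k \<Longrightarrow> loc_unit P (1 - x * y ^ i)) \<Longrightarrow> loc_unit P (qpoch x y k)"
  by (induction k) (simp_all add: qpoch_Suc loc_unit_mult)

section \<open>Calculus of congruences over the localisation\<close>

lemma ratfun_cong_0_iff: "ratfun_cong f g P \<longleftrightarrow> ratfun_cong (f - g) 0 P"
  by (simp add: ratfun_cong_iff)

lemma ratfun_cong_refl: "ratfun_cong f f P"
  unfolding ratfun_cong_iff using loc_0 by force

lemma ratfun_cong_add:
  assumes "ratfun_cong f g P" "ratfun_cong f' g' P"
  shows "ratfun_cong (f + f') (g + g') P"
proof -
  obtain z z' where *: "z \<in> loc P" "f - g = to_fract P * z" "z' \<in> loc P" "f' - g' = to_fract P * z'"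
    using assms unfolding ratfun_cong_iff by blast
  have "f + f' - (g + g') = (f - g) + (f' - g')" by simp
  also have "\<dots> = to_fract P * (z + z')" unfolding * by (simp add: distrib_left)
  finally show ?thesis
    using loc_add[OF *(1,3)] unfolding ratfun_cong_iff by blast
qed

lemma ratfun_cong_mult_left:
  assumes "ratfun_cong f g P" "h \<in> loc P"
  shows "ratfun_cong (h * f) (h * g) P"
proof -
  obtain z where *: "z \<in> loc P" "f - g = to_fract P * z"
    using assms unfolding ratfun_cong_iff by blast
  have "h * f - h * g = h * (f - g)" by (simp add: right_diff_distrib)
  also have "\<dots> = to_fract P * (h * z)" unfolding * by simp
  finally show ?thesis
    using loc_mult[OF assms(2) *(1)] unfolding ratfun_cong_iff by blast
qed

lemma ratfun_cong_trans:
  assumes "ratfun_cong f g P" "ratfun_cong g h P"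
  shows "ratfun_cong f h P"
  using ratfun_cong_add[OF assms[THEN iffD1[OF ratfun_cong_0_iff]]]
  by (subst ratfun_cong_0_iff) simp

lemma ratfun_cong_sym:
  assumes "ratfun_cong f g P"
  shows "ratfun_cong g f P"
  using ratfun_cong_mult_left[OF iffD1[OF ratfun_cong_0_iff assms] loc_to_fract[of "-1"]]
  by (subst ratfun_cong_0_iff) simp

text \<open>From \<open>f * f' - g * g' = (f - g) * f' + g * (f' - g')\<close>; \<open>f'\<close>
  and \<open>g\<close> appear as multipliers and so must lie in \<open>loc P\<close>.\<close>

lemma ratfun_cong_mult:
  assumes "ratfun_cong f g P" "ratfun_cong f' g' P" "f' \<in> loc P" "g \<in> loc P"
  shows "ratfun_cong (f * f') (g * g') P"
  using ratfun_cong_trans[OF _ ratfun_cong_mult_left[OF assms(2,4)], of "f * f'"]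
    ratfun_cong_mult_left[OF assms(1,3)] by (simp add: mult.commute)

lemma ratfun_cong_prod:
  assumes "\<And>i. i \<in> I \<Longrightarrow> ratfun_cong (f i) (g i) P"
    and "\<And>i. i \<in> I \<Longrightarrow> f i \<in> loc P" and "\<And>i. i \<in> I \<Longrightarrow> g i \<in> loc P"
  shows "ratfun_cong (prod f I) (prod g I) P"
  using assms
  by (induction I rule: infinite_finite_induct)
     (simp_all add: ratfun_cong_refl ratfun_cong_mult loc_prod)

lemma ratfun_cong_0_sum:
  "(\<And>i. i \<in> I \<Longrightarrow> ratfun_cong (f i) 0 P) \<Longrightarrow> ratfun_cong (sum f I) 0 P"
proof (induction I rule: infinite_finite_induct)
  case (insert i I)
  then show ?case using ratfun_cong_add[of "f i" 0 P "sum f I" 0] by simp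
qed (simp_all add: ratfun_cong_refl)

lemma ratfun_cong_0_mult_left: "ratfun_cong f 0 P \<Longrightarrow> h \<in> loc P \<Longrightarrow> ratfun_cong (h * f) 0 P"
  using ratfun_cong_mult_left[of f 0 P h] by simp

lemma ratfun_cong_0_mult_right: "ratfun_cong f 0 P \<Longrightarrow> h \<in> loc P \<Longrightarrow> ratfun_cong (f * h) 0 P"
  using ratfun_cong_0_mult_left[of f P h] by (simp add: mult.commute)

lemma ratfun_cong_0_divide: "ratfun_cong f 0 P \<Longrightarrow> loc_unit P h \<Longrightarrow> ratfun_cong (f / h) 0 P"
  unfolding divide_inverse loc_unit_def by (intro ratfun_cong_0_mult_right) auto

lemma ratfun_cong_divideI:
  assumes "ratfun_cong f (h * g) P" "loc_unit P g"
  shows "ratfun_cong (f / g) h P"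
  using ratfun_cong_0_divide[OF iffD1[OF ratfun_cong_0_iff assms(1)] assms(2)]
    loc_unitD(2)[OF assms(2)]
  by (subst ratfun_cong_0_iff) (simp add: diff_divide_distrib)

lemma ratfun_cong_0_qpoch:
  assumes "ratfun_cong (1 - x * y ^ i) 0 P" "i < k" "x \<in> loc P" "y \<in> loc P"
  shows "ratfun_cong (qpoch x y k) 0 P"
proof -
  have "qpoch x y k = (1 - x * y ^ i) * (\<Prod>j\<in>{..<k} - {i}. 1 - x * y ^ j)"
    unfolding qpoch_def using assms(2) by (simp add: prod.remove)
  then show ?thesis
    using assms by (auto intro!: ratfun_cong_0_mult_right loc_prod loc_diff loc_mult loc_power)
qed

text \<open>The witnesses for \<open>P\<close> and \<open>Q\<close> may have different denominators,
  so \<open>f\<close> is put in lowest terms: both moduli then divide the same numerator, hence so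
  does their product.\<close>

lemma ratfun_cong_0_coprime_mult:
  assumes "ratfun_cong f 0 P" "ratfun_cong f 0 Q" "coprime P Q"
  shows "ratfun_cong f 0 (P * Q)"
proof -
  define N where "N = fst (quot_of_fract f)"
  define D where "D = snd (quot_of_fract f)"
  have D: "D \<noteq> 0" and co: "coprime N D" and f: "f = to_fract N / to_fract D"
    unfolding N_def D_def
    by (simp_all add: coprime_quot_of_fract Fract_conv_to_fract[symmetric])
  have key: "R dvd N" if R: "ratfun_cong f 0 R" for R
  proof -
    obtain N' D' where *: "D' \<noteq> 0" "coprime D' R" "f = to_fract R * (to_fract N' / to_fract D')"
      using R unfolding ratfun_cong_def Fract_conv_to_fract diff_0_right by blast
    \<comment> \<open>Cross-multiplication turns the congruence into a divisibility of polynomials,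
      and \<open>R\<close> is coprime to the extra factor \<open>D'\<close>.\<close>
    have "to_fract (N * D') = to_fract (R * N' * D)"
      using f *(1,3) D by (simp add: field_simps)
    then have "N * D' = R * N' * D" by (simp only: to_fract_eq_iff)
    then have "R dvd N * D'" by (simp add: mult.assoc)
    then show "R dvd N" using *(2) by (simp add: coprime_dvd_mult_left_iff coprime_commute)
  qed
  have "P * Q dvd N" using key[OF assms(1)] key[OF assms(2)] assms(3) by (rule divides_mult)
  then obtain M where M: "N = P * Q * M" by (rule dvdE)
  \<comment> \<open>The modulus divides the numerator \<open>N\<close>, which is coprime to
    \<open>D\<close>.\<close>
  have "coprime D (P * Q)" using co unfolding M by (simp add: coprime_commute)
  then show ?thesis
    unfolding ratfun_cong_def Fract_conv_to_fract using D f M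
    by (intro exI[of _ M] exI[of _ D]) simp
qed

section \<open>The truncated series modulo a general modulus\<close>

text \<open>The invertibility that keeps all denominators harmless throughout the iteration. Here
  \<open>q * e\<close> is \<open>q^d\<close>, and \<open>s\<close> is \<open>a\<close> or
  \<open>1 / a\<close>, so one development serves all three factors of the modulus.\<close>

locale quad_modulus =
  fixes P :: poly_qa and q s e :: ratfun_qa and m :: nat
  assumes q: "loc_unit P q" and s: "loc_unit P s" and e: "loc_unit P e"
    and unit_p: "\<And>k. 0 < k \<Longrightarrow> k \<le> 2 * m \<Longrightarrow> loc_unit P (1 - (q * e) ^ k)"
    and unit_s: "\<And>i. 0 < i \<Longrightarrow> loc_unit P (1 - s * (q * e) ^ (2 * i))"
    and unit_inverse_s: "\<And>i. 0 < i \<Longrightarrow> loc_unit P (1 - (q * e) ^ (2 * i) / s)"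
    and unit_q: "\<And>i. i \<le> 3 * m \<Longrightarrow> loc_unit P (1 - q\<^sup>2 * (q * e) ^ (2 * i + 1))"
begin

definition p :: ratfun_qa where "p = q * e"
definition b :: ratfun_qa where "b = q / s"
definition c :: "nat \<Rightarrow> ratfun_qa" where "c j = q * s * p ^ (2 * j)"
definition S :: "nat \<Rightarrow> ratfun_qa" where "S j = (\<Sum>k\<le>2 * m. quad_term b (c j) e p k)"

lemma nonzero: "q \<noteq> 0" "s \<noteq> 0" "e \<noteq> 0" "p \<noteq> 0"
  using q s e by (simp_all add: loc_unit_def p_def)

lemma p: "loc_unit P p"
  unfolding p_def using q e by (rule loc_unit_mult)

lemma c_Suc: "c j * p\<^sup>2 = c (Suc j)"
  by (simp add: c_def power2_eq_square mult_ac)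

text \<open>By \<open>q * e = p\<close>. The first value is \<open>A\<close> after \<open>j\<close>
  shifts; it starts at \<open>q\<close> and gains \<open>p^2\<close> with each shift.\<close>

lemma parameters:
  "b * c j * e / p = q * p ^ (2 * j)" "c j * e * p = s * p ^ (2 * (j + 1))"
  "b * e * p = p\<^sup>2 / s" "b * c j * p = q\<^sup>2 * p ^ (2 * j + 1)"
  using nonzero by (simp_all add: b_def c_def p_def field_simps power2_eq_square)

lemma in_loc: "q \<in> loc P" "s \<in> loc P" "e \<in> loc P" "p \<in> loc P" "b \<in> loc P" "c j \<in> loc P"
  using q s e p
  by (auto simp: b_def c_def intro!: loc_unitD(1) loc_unit_divide loc_unit_mult loc_unit_power)

text \<open>In the last claim the factor of index \<open>i\<close> is
  \<open>1 - q^2 * p^(2 * (j + i) + 1)\<close>, and \<open>i < k\<close> gives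
  \<open>j + i \<le> 3 * m\<close>, the range of \<open>unit_q\<close>.\<close>

lemma units:
  "k \<le> 2 * m \<Longrightarrow> loc_unit P (qpoch p p k)"
  "loc_unit P (qpoch (c j * e * p) (p\<^sup>2) k)"
  "loc_unit P (qpoch (b * e * p) (p\<^sup>2) k)"
  "j + k \<le> 3 * m + 1 \<Longrightarrow> loc_unit P (qpoch (b * c j * p) (p\<^sup>2) k)"
proof -
  show "loc_unit P (qpoch p p k)" if "k \<le> 2 * m"
    using unit_p[folded p_def] that
    by (intro loc_unit_qpoch) (simp only: power_Suc[symmetric])
  have "s * p ^ (2 * (j + 1)) * (p\<^sup>2) ^ i = s * p ^ (2 * (j + 1 + i))" for i
    by (simp only: mult.assoc power_mult[symmetric] power_add[symmetric] distrib_left)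
  then have "loc_unit P (1 - s * p ^ (2 * (j + 1)) * (p\<^sup>2) ^ i)" for i
    using unit_s[folded p_def, of "j + 1 + i"] by (metis add_gr_0 zero_less_one)
  then show "loc_unit P (qpoch (c j * e * p) (p\<^sup>2) k)"
    unfolding parameters by (rule loc_unit_qpoch)
  have "p\<^sup>2 / s * (p\<^sup>2) ^ i = p ^ (2 * Suc i) / s" for i
    by (simp only: power_mult power_Suc times_divide_eq_left)
  then show "loc_unit P (qpoch (b * e * p) (p\<^sup>2) k)"
    using unit_inverse_s[folded p_def]
    by (intro loc_unit_qpoch) (simp only: parameters)
  have "q\<^sup>2 * p ^ (2 * j + 1) * (p\<^sup>2) ^ i = q\<^sup>2 * p ^ (2 * (j + i) + 1)" for i
    by (simp only: mult.assoc power_mult[symmetric] power_add[symmetric] distrib_left add_ac)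
  then show "loc_unit P (qpoch (b * c j * p) (p\<^sup>2) k)" if "j + k \<le> 3 * m + 1"
    using unit_q[folded p_def] that
    by (intro loc_unit_qpoch) (simp only: parameters)
qed

section \<open>Iterating the contiguous relation\<close>

definition ratio :: "nat \<Rightarrow> ratfun_qa" where "ratio j = quad_ratio b (c j) e p"

lemma ratio_eq:
  "ratio j = (1 - q * p ^ (2 * j)) * (1 - s * q * p ^ (2 * j + 1))
     / ((1 - s * p ^ (2 * (j + 1))) * (1 - q\<^sup>2 * p ^ (2 * j + 1)))"
  unfolding ratio_def quad_ratio_def parameters by (simp add: c_def mult_ac)

lemma ratio_in_loc: "j < m \<Longrightarrow> ratio j \<in> loc P"
  unfolding ratio_eq
  by (intro loc_divide loc_mult loc_diff loc_1 in_loc loc_power loc_unit_mult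
      unit_s[folded p_def] unit_q[folded p_def]) auto

lemma S_contiguous:
  assumes "j < m"
  shows "S j = ratio j * S (Suc j) + quad_cert b (c j) e p (2 * m)"
  unfolding S_def ratio_def c_Suc[symmetric]
  using assms by (intro quad_sum_contiguous nonzero loc_unitD(2)[of P] units) auto

text \<open>The two factorials singled out are those in which a factor vanishes: the first modulo
  the cyclotomic polynomial, the second modulo the linear factors in \<open>a\<close>.\<close>

lemma quad_cert_cong_0:
  assumes "j < m"
    and "ratfun_cong (qpoch (q * p ^ (2 * j)) (p\<^sup>2) (Suc (2 * m)) * qpoch (c j * p) p (2 * m)) 0 P"
  shows "ratfun_cong (quad_cert b (c j) e p (2 * m)) 0 P"
proof -
  have "quad_cert b (c j) e p (2 * m)
    = (qpoch (q * p ^ (2 * j)) (p\<^sup>2) (Suc (2 * m)) * qpoch (c j * p) p (2 * m))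
      * (c j * p ^ Suc (2 * m) * qpoch b p (Suc (2 * m)) * qpoch e p (Suc (2 * m))
         * p ^ (2 * m * (2 * m + 1) div 2))
      / (qpoch p p (2 * m) * qpoch (c j * e * p) (p\<^sup>2) (Suc (2 * m))
         * qpoch (b * c j * p) (p\<^sup>2) (Suc (2 * m)) * qpoch (b * e * p) (p\<^sup>2) (2 * m))"
    unfolding quad_cert_def parameters(1) by (simp add: mult_ac)
  also have "ratfun_cong \<dots> 0 P"
    using assms(1)
    by (intro ratfun_cong_0_divide ratfun_cong_0_mult_right[OF assms(2)] loc_mult loc_power loc_qpoch
        in_loc loc_unit_mult units) auto
  finally show ?thesis .
qed

lemma S_0_cong:
  assumes "\<And>j. j < m \<Longrightarrow>
    ratfun_cong (qpoch (q * p ^ (2 * j)) (p\<^sup>2) (Suc (2 * m)) * qpoch (c j * p) p (2 * m)) 0 P"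
  shows "ratfun_cong (S 0) ((\<Prod>j<m. ratio j) * S m) P"
proof -
  have "ratfun_cong (S 0) ((\<Prod>j<i. ratio j) * S i) P" if "i \<le> m" for i
    using that
  proof (induction i)
    case (Suc i)
    have "ratfun_cong (S i) (ratio i * S (Suc i)) P"
      using quad_cert_cong_0[OF _ assms, of i] Suc.prems S_contiguous[of i]
      by (subst ratfun_cong_0_iff) simp
    then have "ratfun_cong ((\<Prod>j<i. ratio j) * S i) ((\<Prod>j<i. ratio j) * (ratio i * S (Suc i))) P"
      using Suc.prems by (intro ratfun_cong_mult_left loc_prod ratio_in_loc) auto
    then show ?case
      using ratfun_cong_trans[OF Suc.IH] Suc.prems by (simp add: mult.assoc)
  qed (simp add: ratfun_cong_refl)
  then show ?thesis by simp
qed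

text \<open>After \<open>m\<close> shifts \<open>A\<close> is congruent to \<open>1\<close>. The
  term \<open>k = 0\<close> is \<open>1 - A\<close>, and every later term contains
  \<open>1 - A\<close> as the first factor of a factorial.\<close>

lemma S_0_cong_0:
  assumes *: "ratfun_cong (1 - q * p ^ (2 * m)) 0 P"
  shows "ratfun_cong (S 0) 0 P"
proof -
  have "ratfun_cong (qpoch (q * p ^ (2 * j)) (p\<^sup>2) (Suc (2 * m)) * qpoch (c j * p) p (2 * m)) 0 P"
    if "j < m" for j
  \<comment> \<open>Index \<open>m - j\<close> is where the factor \<open>1 - q * p^(2 * m)\<close>
    sits.\<close>
  proof (intro ratfun_cong_0_mult_right ratfun_cong_0_qpoch[where i = "m - j"]
      loc_qpoch loc_mult loc_power in_loc)
    have "2 * j + 2 * (m - j) = 2 * m" using that by simp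
    then have "q * p ^ (2 * j) * (p\<^sup>2) ^ (m - j) = q * p ^ (2 * m)"
      by (simp only: mult.assoc power_mult[symmetric] power_add[symmetric])
    then show "ratfun_cong (1 - q * p ^ (2 * j) * (p\<^sup>2) ^ (m - j)) 0 P" using * by (simp only:)
  qed auto
  then have "ratfun_cong (S 0) ((\<Prod>j<m. ratio j) * S m) P" by (rule S_0_cong)
  moreover have "ratfun_cong (quad_term b (c m) e p k) 0 P" if "k \<le> 2 * m" for k
  proof -
    have "ratfun_cong ((1 - q * p ^ (2 * m) * p ^ (3 * k)) * qpoch (q * p ^ (2 * m)) (p\<^sup>2) k) 0 P"
    proof (cases k)
      case 0
      then show ?thesis using * by simp
    next
      case (Suc k')
      have "ratfun_cong (qpoch (q * p ^ (2 * m)) (p\<^sup>2) k) 0 P"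
        using * Suc by (intro ratfun_cong_0_qpoch[where i = 0] loc_mult loc_power in_loc) auto
      then show ?thesis
        by (intro ratfun_cong_0_mult_left loc_diff loc_mult loc_power in_loc loc_1)
    qed
    then have "ratfun_cong ((1 - q * p ^ (2 * m) * p ^ (3 * k)) * qpoch (q * p ^ (2 * m)) (p\<^sup>2) k
      * (qpoch b p k * qpoch (c m) p k * qpoch e p k * p ^ (k * (k + 1) div 2))
      / (qpoch p p k * qpoch (c m * e * p) (p\<^sup>2) k * qpoch (b * e * p) (p\<^sup>2) k
        * qpoch (b * c m * p) (p\<^sup>2) k)) 0 P"
      using that
      by (intro ratfun_cong_0_divide ratfun_cong_0_mult_right[of "_ * _"] loc_mult loc_power loc_qpoch in_loc
        loc_unit_mult units) auto
    then show ?thesis unfolding quad_term_def parameters(1) by (simp add: mult_ac)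
  qed
  then have "ratfun_cong (S m) 0 P" unfolding S_def by (intro ratfun_cong_0_sum) simp
  then have "ratfun_cong ((\<Prod>j<m. ratio j) * S m) 0 P"
    by (intro ratfun_cong_0_mult_left loc_prod ratio_in_loc) auto
  ultimately show ?thesis by (rule ratfun_cong_trans)
qed

text \<open>Reversing the order of the factors that contain \<open>s\<close> expresses them through
  \<open>u = s * q * p^(2 * m)\<close>, which is congruent to \<open>1\<close>. Each quotient then
  collapses to \<open>(1 - p^(2 * i + 1)) * (q / p)\<close>.\<close>

lemma prod_ratio_cong:
  assumes *: "ratfun_cong (1 - s * q * p ^ (2 * m)) 0 P"
  shows "ratfun_cong (\<Prod>j<m. ratio j) (qpoch p (p\<^sup>2) m / qpoch (q\<^sup>2 * p) (p\<^sup>2) m * (q / p) ^ m) P"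
proof -
  define u where "u = s * q * p ^ (2 * m)"
  \<comment> \<open>\<open>X i\<close> and \<open>Y i\<close> pair factor \<open>i\<close> without
    \<open>s\<close> with the factors of index \<open>m - 1 - i\<close> that contain
    \<open>s\<close>; \<open>Z i\<close> is the value of \<open>X i / Y i\<close> at
    \<open>u = 1\<close>.\<close>
  define X where "X i = (1 - q * p ^ (2 * i)) * (1 - u / p ^ (2 * i + 1))" for i
  define Y where "Y i = 1 - u / (q * p ^ (2 * i))" for i
  define Z where "Z i = (1 - p * (p\<^sup>2) ^ i) * (q / p)" for i
  have u: "u \<in> loc P" unfolding u_def by (intro loc_mult loc_power in_loc)
  have split_p: "p ^ (2 * m) = p ^ (2 * (m - Suc i + 1)) * p ^ (2 * i)"
    "p ^ (2 * m) = p ^ (2 * (m - Suc i) + 1) * p ^ (2 * i + 1)" if "i < m" for i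
  proof -
    have "2 * (m - Suc i + 1) + 2 * i = 2 * m" "2 * (m - Suc i) + 1 + (2 * i + 1) = 2 * m"
      using that by simp_all
    then show "p ^ (2 * m) = p ^ (2 * (m - Suc i + 1)) * p ^ (2 * i)"
      "p ^ (2 * m) = p ^ (2 * (m - Suc i) + 1) * p ^ (2 * i + 1)"
      by (simp_all only: power_add[symmetric])
  qed
  have Y_eq: "Y i = 1 - s * p ^ (2 * (m - Suc i + 1))" if "i < m" for i
    unfolding Y_def u_def split_p(1)[OF that] using nonzero by simp
  have Y: "loc_unit P (Y i)" if "i < m" for i
    unfolding Y_eq[OF that] by (rule unit_s[folded p_def]) simp
  have X_eq: "X i = (1 - q * p ^ (2 * i)) * (1 - s * q * p ^ (2 * (m - Suc i) + 1))" if "i < m" for i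
    unfolding X_def u_def split_p(2)[OF that] using nonzero by simp
  have X: "X i \<in> loc P" for i
    unfolding X_def by (intro loc_mult loc_diff loc_divide loc_1 loc_power in_loc u loc_unit_power p)
  have Z: "Z i \<in> loc P" for i
    unfolding Z_def by (intro loc_mult loc_diff loc_divide loc_1 loc_power in_loc p)
  have "ratfun_cong (X i / Y i) (Z i) P" if "i < m" for i
  proof (rule ratfun_cong_divideI[OF _ Y[OF that]])
    define w where "w = q * p ^ (2 * i)"
    define v where "v = p ^ (2 * i + 1)"
    have [simp]: "w \<noteq> 0" "v \<noteq> 0" using nonzero by (simp_all add: w_def v_def)
    have wv: "q / p = w / v" using nonzero by (simp add: w_def v_def)
    have v': "p * (p\<^sup>2) ^ i = v" by (simp add: v_def power_mult)
    \<comment> \<open>An exact identity that isolates the vanishing factor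
      \<open>1 - u\<close>.\<close>
    have "X i - Z i * Y i = (1 - u) * ((v - w) / v)"
      unfolding X_def Y_def Z_def v' wv w_def[symmetric] v_def[symmetric]
      by (simp add: field_simps)
    moreover have "ratfun_cong ((1 - u) * ((v - w) / v)) 0 P"
      unfolding v_def w_def using *[folded u_def]
      by (intro ratfun_cong_0_mult_right loc_mult loc_diff loc_divide loc_power in_loc loc_unit_power p)
    ultimately show "ratfun_cong (X i) (Z i * Y i) P" by (subst ratfun_cong_0_iff) simp
  qed
  then have cong: "ratfun_cong (\<Prod>i<m. X i / Y i) (\<Prod>i<m. Z i) P"
    using X Y Z by (intro ratfun_cong_prod loc_divide) auto
  have den: "q\<^sup>2 * p ^ (2 * j + 1) = q\<^sup>2 * p * (p\<^sup>2) ^ j" for j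
    by (simp add: power_mult)
  have "(\<Prod>j<m. ratio j) = (\<Prod>j<m. 1 - q * p ^ (2 * j)) * (\<Prod>j<m. 1 - s * q * p ^ (2 * j + 1))
      / ((\<Prod>j<m. 1 - s * p ^ (2 * (j + 1))) * qpoch (q\<^sup>2 * p) (p\<^sup>2) m)"
    unfolding ratio_eq qpoch_def den by (simp only: prod.distrib prod_dividef)
  also have "(\<Prod>j<m. 1 - s * q * p ^ (2 * j + 1)) = (\<Prod>i<m. 1 - s * q * p ^ (2 * (m - Suc i) + 1))"
    by (rule prod.nat_diff_reindex[symmetric])
  also have "(\<Prod>j<m. 1 - s * p ^ (2 * (j + 1))) = (\<Prod>i<m. 1 - s * p ^ (2 * (m - Suc i + 1)))"
    by (rule prod.nat_diff_reindex[symmetric])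
  also have "\<dots> = (\<Prod>i<m. Y i)" by (intro prod.cong) (simp_all only: Y_eq lessThan_iff)
  also have "(\<Prod>j<m. 1 - q * p ^ (2 * j)) * (\<Prod>i<m. 1 - s * q * p ^ (2 * (m - Suc i) + 1)) = (\<Prod>i<m. X i)"
    unfolding prod.distrib[symmetric] by (intro prod.cong) (simp_all only: X_eq lessThan_iff)
  finally have eq: "(\<Prod>j<m. ratio j) = inverse (qpoch (q\<^sup>2 * p) (p\<^sup>2) m) * (\<Prod>i<m. X i / Y i)"
    by (simp add: prod_dividef field_simps)
  have "loc_unit P (qpoch (q\<^sup>2 * p) (p\<^sup>2) m)"
    using units(4)[of 0 m] by (simp add: parameters)
  then have "ratfun_cong (\<Prod>j<m. ratio j) (inverse (qpoch (q\<^sup>2 * p) (p\<^sup>2) m) * (\<Prod>i<m. Z i)) P"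
    unfolding eq by (intro ratfun_cong_mult_left cong) (simp add: loc_unit_def)
  moreover have "(\<Prod>i<m. Z i) = qpoch p (p\<^sup>2) m * (q / p) ^ m"
    unfolding Z_def prod.distrib qpoch_def by simp
  ultimately show ?thesis by (simp add: field_simps)
qed

text \<open>Here \<open>c m\<close> is congruent to \<open>1\<close>, so
  \<open>qpoch (c m) p k\<close> vanishes for \<open>k > 0\<close> and \<open>S m\<close> reduces to
  its constant term.\<close>

lemma S_0_cong_product:
  assumes *: "ratfun_cong (1 - s * q * p ^ (2 * m)) 0 P"
  shows "ratfun_cong (S 0)
    (qpoch p (p\<^sup>2) m / qpoch (q\<^sup>2 * p) (p\<^sup>2) m * (q / p) ^ m * (1 - q * p ^ (2 * m))) P"
proof -
  have cm: "c m = s * q * p ^ (2 * m)" by (simp add: c_def mult_ac)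
  have "ratfun_cong (qpoch (q * p ^ (2 * j)) (p\<^sup>2) (Suc (2 * m)) * qpoch (c j * p) p (2 * m)) 0 P"
    if "j < m" for j
  \<comment> \<open>The factor \<open>1 - c m\<close> of \<open>qpoch (c j * p) p (2 * m)\<close>;
    the natural subtraction is exact because \<open>j < m\<close>.\<close>
  proof (intro ratfun_cong_0_mult_left ratfun_cong_0_qpoch[where i = "2 * (m - j) - 1"]
      loc_qpoch loc_mult loc_power in_loc)
    have "2 * j + Suc (2 * (m - j) - 1) = 2 * m" using that by simp
    then have "p ^ (2 * j) * (p * p ^ (2 * (m - j) - 1)) = p ^ (2 * m)"
      by (simp only: power_Suc[symmetric] power_add[symmetric])
    then have "c j * p * p ^ (2 * (m - j) - 1) = s * q * p ^ (2 * m)"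
      by (simp add: c_def mult_ac)
    then show "ratfun_cong (1 - c j * p * p ^ (2 * (m - j) - 1)) 0 P" using * by (simp only:)
  qed (use that in auto)
  then have S0: "ratfun_cong (S 0) ((\<Prod>j<m. ratio j) * S m) P" by (rule S_0_cong)
  have "ratfun_cong (quad_term b (c m) e p k) 0 P" if "k \<le> 2 * m" "0 < k" for k
  proof -
    have "ratfun_cong (qpoch (c m) p k) 0 P"
      using * that cm by (intro ratfun_cong_0_qpoch[where i = 0] in_loc) auto
    then have "ratfun_cong (qpoch (c m) p k
      * ((1 - q * p ^ (2 * m) * p ^ (3 * k)) * qpoch (q * p ^ (2 * m)) (p\<^sup>2) k
         * qpoch b p k * qpoch e p k * p ^ (k * (k + 1) div 2))
      / (qpoch p p k * qpoch (c m * e * p) (p\<^sup>2) k * qpoch (b * e * p) (p\<^sup>2) k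
        * qpoch (b * c m * p) (p\<^sup>2) k)) 0 P"
      using that
      by (intro ratfun_cong_0_divide ratfun_cong_0_mult_right loc_mult loc_power loc_qpoch in_loc
        loc_unit_mult units loc_diff loc_1) auto
    then show ?thesis unfolding quad_term_def parameters(1) by (simp add: mult_ac)
  qed
  then have "ratfun_cong (\<Sum>k\<in>{..2 * m} - {0}. quad_term b (c m) e p k) 0 P"
    by (intro ratfun_cong_0_sum) auto
  moreover have "S m = (1 - q * p ^ (2 * m)) + (\<Sum>k\<in>{..2 * m} - {0}. quad_term b (c m) e p k)"
  proof -
    have "quad_term b (c m) e p 0 = 1 - q * p ^ (2 * m)"
      by (simp add: quad_term_def parameters(1))
    then show ?thesis unfolding S_def by (subst sum.remove[of _ 0]) simp_all
  qed
  ultimately have "ratfun_cong (S m) (1 - q * p ^ (2 * m)) P"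
    by (subst ratfun_cong_0_iff) simp
  then have "ratfun_cong ((\<Prod>j<m. ratio j) * S m) ((\<Prod>j<m. ratio j) * (1 - q * p ^ (2 * m))) P"
    by (intro ratfun_cong_mult_left loc_prod ratio_in_loc) auto
  with S0 have "ratfun_cong (S 0) ((\<Prod>j<m. ratio j) * (1 - q * p ^ (2 * m))) P"
    by (rule ratfun_cong_trans)
  moreover have "ratfun_cong ((\<Prod>j<m. ratio j) * (1 - q * p ^ (2 * m)))
     (qpoch p (p\<^sup>2) m / qpoch (q\<^sup>2 * p) (p\<^sup>2) m * (q / p) ^ m * (1 - q * p ^ (2 * m))) P"
    using ratfun_cong_mult_left[OF prod_ratio_cong[OF *], of "1 - q * p ^ (2 * m)"]
    by (simp add: mult.commute loc_diff loc_mult loc_power in_loc)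
  ultimately show ?thesis by (rule ratfun_cong_trans)
qed

end

section \<open>Coprimality with the three factors of the modulus\<close>

lemma cyclotomic_nonzero: "n > 0 \<Longrightarrow> cyclotomic n \<noteq> 0"
proof
  assume "n > 0" "cyclotomic n = 0"
  then have "(\<Prod>z\<in>primitive_roots_unity n. [:- z, 1:]) = 0"
    using of_rat_cyclotomic[of n] by simp
  moreover have "(\<Prod>z\<in>A. [:- z, 1:]) \<noteq> 0" for A :: "complex set"
    by (induction A rule: infinite_finite_induct) (simp_all del: mult_pCons_left)
  ultimately show False by blast
qed

text \<open>Over the complex numbers the cofactor is the product over the remaining divisors of
  \<open>n\<close>; \<open>rational_cofactor\<close> makes it rational.\<close>

lemma cyclotomic_dvd:
  assumes "n > 0"
  shows "cyclotomic n dvd monom 1 n - 1"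
proof -
  let ?C = "\<lambda>d. \<Prod>z\<in>primitive_roots_unity d. [:- z, 1:]"
  have "of_rat_poly (monom 1 n - 1) = (\<Prod>d | d dvd n. ?C d)"
    using prod_primitive_roots_unity[OF assms] by (simp add: of_rat_poly_diff map_poly_monom)
  also have "\<dots> = of_rat_poly (cyclotomic n) * (\<Prod>d\<in>{d. d dvd n} - {n}. ?C d)"
    unfolding of_rat_cyclotomic[OF assms] using assms by (intro prod.remove) simp_all
  finally have eq: "of_rat_poly (monom 1 n - 1)
      = of_rat_poly (cyclotomic n) * (\<Prod>d\<in>{d. d dvd n} - {n}. ?C d)" .
  obtain Q where "of_rat_poly Q = (\<Prod>d\<in>{d. d dvd n} - {n}. ?C d)"
    using rational_cofactor[OF cyclotomic_nonzero[OF assms] eq] by blast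
  then have "of_rat_poly (monom 1 n - 1) = of_rat_poly (cyclotomic n * Q)"
    using eq by (simp only: of_rat_poly_mult)
  then have "monom 1 n - 1 = cyclotomic n * Q" by (simp only: of_rat_poly_inj)
  then show ?thesis by simp
qed

lemma poly_of_rat_cyclotomic_eq_0:
  assumes "n > 0" "poly (of_rat_poly (cyclotomic n)) z = 0"
  shows "z \<in> primitive_roots_unity n"
proof -
  have "z \<in> A" if "poly (\<Prod>z\<in>A. [:- z, 1:]) z = 0" for A :: "complex set"
    using that by (induction A rule: infinite_finite_induct) (auto simp: algebra_simps)
  then show ?thesis using assms by (simp add: of_rat_cyclotomic)
qed

lemma primitive_roots_unity_power_eq_1:
  assumes "n > 0" "z \<in> primitive_roots_unity n" "z ^ k = 1"
  shows "n dvd k"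
proof -
  have z: "z ^ n = 1" "\<And>m. 0 < m \<Longrightarrow> m < n \<Longrightarrow> z ^ m \<noteq> 1"
    using assms(2) by (auto simp: primitive_roots_unity_def)
  have "z ^ k = (z ^ n) ^ (k div n) * z ^ (k mod n)"
    by (simp only: power_mult[symmetric] power_add[symmetric] mult_div_mod_eq)
  then have "z ^ (k mod n) = 1" using assms(3) z(1) by simp
  then have "k mod n = 0" using z(2)[of "k mod n"] assms(1) by auto
  then show ?thesis by auto
qed

text \<open>A nonconstant common divisor would have a complex root, which would be a primitive root
  of unity at which \<open>u\<close> vanishes.\<close>

lemma coprime_cyclotomic:
  assumes "n > 0" "\<And>z. z \<in> primitive_roots_unity n \<Longrightarrow> poly (of_rat_poly u) z \<noteq> 0"
  shows "coprime u (cyclotomic n)"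
proof (rule coprimeI)
  fix r assume r: "r dvd u" "r dvd cyclotomic n"
  have r0: "r \<noteq> 0" using r(2) cyclotomic_nonzero[OF assms(1)] by auto
  have "degree r = 0"
  proof (rule ccontr)
    assume "degree r \<noteq> 0"
    then have "\<not> constant (poly (of_rat_poly r))" by (simp add: constant_degree degree_of_rat_poly)
    then obtain z where z: "poly (of_rat_poly r) z = 0"
      using fundamental_theorem_of_algebra by blast
    have root: "poly (of_rat_poly v) z = 0" if "r dvd v" for v
      using that z by (auto simp: of_rat_poly_mult elim!: dvdE)
    show False
      using assms(2)[OF poly_of_rat_cyclotomic_eq_0[OF assms(1) root[OF r(2)]]] root[OF r(1)] by simp
  qed
  then show "is_unit r" using r0 by (simp add: is_unit_iff_degree)
qed

section \<open>Coprimality in two variables\<close>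

lemma dvd_const_polyE:
  fixes v :: "'a::idom"
  assumes "t dvd [:v:]" "v \<noteq> 0"
  obtains w where "t = [:w:]"
proof -
  have "degree t \<le> degree [:v:]" using assms by (intro dvd_imp_degree_le) simp_all
  then show ?thesis using that degree_eq_zeroE[of t] by auto
qed

lemma coprime_const_poly:
  fixes u v :: "rat poly"
  assumes "coprime u v" "v \<noteq> 0"
  shows "coprime [:u:] [:v:]"
proof (rule coprimeI)
  fix t assume t: "t dvd [:u:]" "t dvd [:v:]"
  obtain w where w: "t = [:w:]" using dvd_const_polyE[OF t(2) assms(2)] .
  then have "w dvd u" "w dvd v" using t by (simp_all add: const_poly_dvd_const_poly_iff)
  then have "is_unit w" using assms(1) by (meson coprime_common_divisor)
  then show "is_unit t" by (simp add: w is_unit_const_poly_iff)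
qed

text \<open>A common divisor is free of \<open>a\<close>, hence divides every coefficient of
  \<open>r\<close>, including the unit.\<close>

lemma coprime_poly_const_poly:
  fixes v :: "rat poly"
  assumes "is_unit (coeff r i)" "v \<noteq> 0"
  shows "coprime r [:v:]"
proof (rule coprimeI)
  fix t assume t: "t dvd r" "t dvd [:v:]"
  obtain w where w: "t = [:w:]" using dvd_const_polyE[OF t(2) assms(2)] .
  then have "w dvd coeff r i" using t by (simp add: const_poly_dvd_iff)
  then have "is_unit w" using assms(1) dvd_trans by blast
  then show "is_unit t" by (simp add: w is_unit_const_poly_iff)
qed

text \<open>A polynomial of degree one in \<open>a\<close> with a unit coefficient is irreducible, so it is coprime to
  every \<open>r\<close> that does not vanish at some rational point \<open>(q, a) = (\<beta>, \<alpha>)\<close> of its zero set.\<close>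
lemma coprime_linear:
  fixes r R :: poly_qa
  assumes "degree R = 1" "is_unit (coeff R i)"
    and "poly (poly R [:\<alpha>:]) \<beta> = 0" "poly (poly r [:\<alpha>:]) \<beta> \<noteq> 0"
  shows "coprime r R"
proof (rule coprimeI)
  fix t assume t: "t dvd r" "t dvd R"
  obtain k where k: "R = t * k" using t(2) by (rule dvdE)
  have const_unit: "is_unit x" if x: "x dvd R" "degree x = 0" for x
  proof -
    obtain w where w: "x = [:w:]" using x(2) by (rule degree_eq_zeroE)
    then have "w dvd coeff R i" using x(1) by (simp add: const_poly_dvd_iff)
    then have "is_unit w" using assms(2) dvd_trans by blast
    then show ?thesis by (simp add: w is_unit_const_poly_iff)
  qed
  have "t \<noteq> 0" "k \<noteq> 0" using k assms(1) by auto
  then have "degree t + degree k = 1" using k assms(1) by (simp add: degree_mult_eq)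
  then consider "degree t = 0" | "degree k = 0" by linarith
  then show "is_unit t"
  proof cases
    case 1
    then show ?thesis using const_unit t(2) by blast
  next
    case 2
    then have "is_unit k" using const_unit k by simp
    then have "R dvd r" using k t(1) by (simp add: mult_unit_dvd_iff)
    then show ?thesis using assms(3,4) by (auto elim!: dvdE)
  qed
qed

lemma poly_q_power: "poly_q ^ k = [:monom 1 k:]"
  by (induction k) (simp_all add: poly_q_def monom_Suc one_pCons)

lemma degree_moduli:
  assumes "n > 0"
  shows "degree (1 - poly_a * poly_q ^ n) = 1" "degree (poly_a - poly_q ^ n) = 1"
    "coeff (1 - poly_a * poly_q ^ n) 0 = 1" "coeff (poly_a - poly_q ^ n) 1 = 1"
proof -
  have 1: "1 - poly_a * poly_q ^ n = [:1, - monom 1 n:]" "poly_a - poly_q ^ n = [:- monom 1 n, 1:]"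
    unfolding poly_q_power poly_a_def by (simp_all add: one_pCons)
  show "degree (1 - poly_a * poly_q ^ n) = 1" "degree (poly_a - poly_q ^ n) = 1"
    "coeff (1 - poly_a * poly_q ^ n) 0 = 1" "coeff (poly_a - poly_q ^ n) 1 = 1"
    unfolding 1 by simp_all
qed

section \<open>The congruence\<close>

lemma to_fract_power: "to_fract (x ^ k) = to_fract x ^ k"
  by (induction k) simp_all

text \<open>This symmetry exchanges \<open>a\<close> and \<open>1 / a\<close>, so
  \<open>a - q^n\<close> is handled like \<open>1 - a * q^n\<close>.\<close>

lemma quad_term_commute: "quad_term b c e p k = quad_term c b e p k"
  by (simp add: quad_term_def mult_ac)

text \<open>The specialisation \<open>p = q^d\<close>, \<open>b = q / a\<close>,
  \<open>c = q * a\<close>, \<open>e = q^(d-1)\<close>, for which \<open>A = q\<close>; the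
  denominator \<open>1 - q\<close> comes from the \<open>q\<close>-integer.\<close>

lemma summand_eq_quad_term:
  fixes q a :: "'a::field"
  assumes "q \<noteq> 0" "a \<noteq> 0" "d > 0"
  shows "qint q (3 * d * k + 1)
       * (qpoch q (q ^ (2 * d)) k * qpoch (q ^ (d - 1)) (q ^ d) k
          * (qpoch (a * q) (q ^ d) k * qpoch (q / a) (q ^ d) k))
       / (qpoch (q ^ d) (q ^ d) k * qpoch (q ^ (d + 2)) (q ^ (2 * d)) k
          * (qpoch (a * q ^ (2 * d)) (q ^ (2 * d)) k * qpoch (q ^ (2 * d) / a) (q ^ (2 * d)) k))
       * q ^ (d * (k\<^sup>2 + k) div 2)
    = quad_term (q / a) (q * a) (q ^ (d - 1)) (q * q ^ (d - 1)) k / (1 - q)"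
proof -
  define p where "p = q ^ d"
  define e where "e = q ^ (d - 1)"
  have pe: "p = q * e" using assms(3) by (cases d) (simp_all add: p_def e_def)
  have e0: "e \<noteq> 0" using assms(1) by (simp add: e_def)
  have p2: "q ^ (2 * d) = p\<^sup>2" by (simp add: p_def power_mult[symmetric] mult.commute)
  have pd: "q ^ (d + 2) = q\<^sup>2 * p" by (simp add: p_def power_add power2_eq_square mult.commute)
  have p3: "q ^ (3 * d * k + 1) = q * p ^ (3 * k)"
    by (simp add: p_def power_mult[symmetric] mult_ac)
  \<comment> \<open>The division is exact, \<open>k * (k + 1)\<close> being even.\<close>
  have tri: "d * (k\<^sup>2 + k) div 2 = d * (k * (k + 1) div 2)"
    by (simp add: power2_eq_square div_mult_swap add.commute)
  have pt: "q ^ (d * (k\<^sup>2 + k) div 2) = p ^ (k * (k + 1) div 2)"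
    unfolding tri p_def by (rule power_mult)
  have param: "q / a * (q * a) * e / p = q" "q * a * e * p = a * p\<^sup>2" "q / a * e * p = p\<^sup>2 / a"
    "q / a * (q * a) * p = q\<^sup>2 * p"
    using assms e0 by (simp_all add: pe field_simps power2_eq_square)
  show ?thesis
    unfolding quad_term_def pe[symmetric] e_def[symmetric] p_def[symmetric] param p2 pd p3 pt qint_def
    by (simp add: mult_ac)
qed

lemma product_eq:
  fixes q :: "'a::field"
  assumes "q \<noteq> 0" "d > 0"
  shows "qpoch (q ^ d) (q ^ (2 * d)) m / qpoch (q ^ (d + 2)) (q ^ (2 * d)) m
       * qint q (2 * d * m + 1) * q powi (- int (m * (d - 1)))
    = qpoch (q * q ^ (d - 1)) ((q * q ^ (d - 1))\<^sup>2) m / qpoch (q\<^sup>2 * (q * q ^ (d - 1))) ((q * q ^ (d - 1))\<^sup>2) m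
       * (q / (q * q ^ (d - 1))) ^ m * (1 - q * (q * q ^ (d - 1)) ^ (2 * m)) / (1 - q)"
proof -
  have p: "q * q ^ (d - 1) = q ^ d" using assms(2) by (cases d) simp_all
  have p2: "(q ^ d)\<^sup>2 = q ^ (2 * d)" by (simp add: power_mult[symmetric] mult.commute)
  have pd: "q\<^sup>2 * q ^ d = q ^ (d + 2)" by (simp add: power_add power2_eq_square mult.commute)
  have pm: "q * (q ^ d) ^ (2 * m) = q ^ (2 * d * m + 1)"
    by (simp add: power_mult[symmetric] mult_ac)
  have "q / q ^ d = inverse (q ^ (d - 1))" unfolding p[symmetric] using assms(1) by (simp add: field_simps)
  then have pw: "(q / q ^ d) ^ m = q powi (- int (m * (d - 1)))"
    by (simp add: power_int_minus power_inverse power_mult[symmetric] mult.commute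
        del: of_nat_mult)
  show ?thesis unfolding p p2 pd pm pw qint_def by (simp add: mult_ac)
qed

text \<open>The same four families of units serve both choices of \<open>s\<close>, since
  \<open>1 - x / a = (a - x) / a\<close> and \<open>a\<close> is a unit.\<close>

lemma quad_modulusI:
  defines "q \<equiv> ratfun_q" and "a \<equiv> ratfun_a"
  assumes "d > 0" and q: "loc_unit P q" and a: "loc_unit P a"
    and "\<And>k. 0 < k \<Longrightarrow> k \<le> 2 * m \<Longrightarrow> loc_unit P (1 - q ^ (d * k))"
    and "\<And>i. i \<le> 3 * m \<Longrightarrow> loc_unit P (1 - q ^ (d * (2 * i + 1) + 2))"
    and "\<And>i. 0 < i \<Longrightarrow> loc_unit P (1 - a * q ^ (2 * d * i))"
    and "\<And>i. 0 < i \<Longrightarrow> loc_unit P (a - q ^ (2 * d * i))"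
  shows "quad_modulus P q a (q ^ (d - 1)) m" "quad_modulus P q (1 / a) (q ^ (d - 1)) m"
proof -
  have p: "q * q ^ (d - 1) = q ^ d" using assms(3) by (cases d) simp_all
  have pp: "(q ^ d) ^ k = q ^ (d * k)" "q\<^sup>2 * q ^ k = q ^ (k + 2)" for k
    by (simp_all add: power_mult power_add power2_eq_square mult.commute)
  have dd: "d * (2 * i) = 2 * d * i" for i by simp
  have a0: "a \<noteq> 0" using a by (rule loc_unitD)
  have inv: "loc_unit P (1 - q ^ (2 * d * i) / a)" if "0 < i" for i
  proof -
    have "1 - q ^ (2 * d * i) / a = (a - q ^ (2 * d * i)) / a" using a0 by (simp add: field_simps)
    then show ?thesis using assms(9)[OF that] a by (simp add: loc_unit_divide)
  qed
  show "quad_modulus P q a (q ^ (d - 1)) m"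
    unfolding quad_modulus_def p pp dd
    using assms(6-8) q a inv by (simp add: loc_unit_power)
  show "quad_modulus P q (1 / a) (q ^ (d - 1)) m"
    unfolding quad_modulus_def p pp dd
    using assms(6-8) q a inv a0 by (simp add: loc_unit_power loc_unit_divide mult.commute)
qed

text \<open>Keeps the factors of \<open>qpoch (q ^ (d + 2)) (q ^ (2 * d))\<close> invertible modulo
  the cyclotomic polynomial. A quotient \<open>t\<close> satisfies
  \<open>t = d + 2 + 2 * d * z\<close> with \<open>z = i - m * t\<close>: negative \<open>z\<close>
  forces \<open>t = 0\<close>, and otherwise \<open>t \<ge> 4\<close> makes
  \<open>i \<ge> 4 * m\<close>.\<close>

lemma not_dvd_exponent:
  fixes d m i :: nat
  assumes "d > 1" "m > 0" "i \<le> 3 * m"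
  shows "\<not> 2 * d * m + 1 dvd d * (2 * i + 1) + 2"
proof
  assume "2 * d * m + 1 dvd d * (2 * i + 1) + 2"
  then obtain t where t: "d * (2 * i + 1) + 2 = (2 * d * m + 1) * t" by (rule dvdE)
  define z where "z = int i - int m * int t"
  have "int (d * (2 * i + 1) + 2) = int ((2 * d * m + 1) * t)" using t by (rule arg_cong)
  then have tz: "int t = int d + 2 + 2 * int d * z"
    by (simp add: z_def algebra_simps)
  have "z \<ge> 0"
  proof (rule ccontr)
    assume "\<not> z \<ge> 0"
    then have "int d * z \<le> int d * (- 1)" by (intro mult_left_mono) simp_all
    then have "int t \<le> 2 - int d" using tz by simp
    then have "t = 0" using assms(1) by simp
    then show False using t by simp
  qed
  then have "int d * z \<ge> 0" by simp
  then have "int t \<ge> 4" using tz assms(1) by simp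
  then have "int m * int t \<ge> int m * 4" by (intro mult_left_mono) simp_all
  then have "int i \<ge> int m * 4" using \<open>z \<ge> 0\<close> by (simp add: z_def)
  then show False using assms(2,3) by simp
qed

lemma ratfun_cong_0_dvd: "P dvd r \<Longrightarrow> ratfun_cong (to_fract r) 0 P"
  unfolding ratfun_cong_iff by (auto intro: loc_to_fract elim!: dvdE)

lemma to_fract_one_minus_power:
  "to_fract (1 - poly_q ^ k) = 1 - ratfun_q ^ k"
  "to_fract (1 - poly_a * poly_q ^ k) = 1 - ratfun_a * ratfun_q ^ k"
  "to_fract (poly_a - poly_q ^ k) = ratfun_a - ratfun_q ^ k"
  by (simp_all add: to_fract_power ratfun_q_def ratfun_a_def)

lemma poly_poly_q_a:
  "poly (poly poly_q [:\<alpha>:]) \<beta> = \<beta>" "poly (poly poly_a [:\<alpha>:]) \<beta> = \<alpha>"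
  by (simp_all add: poly_q_def poly_a_def)

lemma loc_unit_linear:
  assumes "degree R = 1" "is_unit (coeff R i)"
    and "poly (poly R [:\<alpha>:]) \<beta> = 0" "poly (poly r [:\<alpha>:]) \<beta> \<noteq> 0"
  shows "loc_unit R (to_fract r)"
proof (rule loc_unit_to_fract[OF _ coprime_linear[OF assms]])
  show "r \<noteq> 0" using assms(4) by auto
qed

lemma power_of_2_inject: "(2::rat) ^ i = 2 ^ j \<longleftrightarrow> i = j"
  by (rule power_inject_exp) simp

section \<open>The locale at the three factors of the modulus\<close>

lemma quad_modulus_1_minus_aq:
  fixes d m :: nat
  assumes "d > 1"
  defines "n \<equiv> 2 * d * m + 1"
  shows "quad_modulus (1 - poly_a * poly_q ^ n) ratfun_q ratfun_a (ratfun_q ^ (d - 1)) m"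
    and "loc_unit (1 - poly_a * poly_q ^ n) (1 - ratfun_q)"
proof -
  let ?R = "1 - poly_a * poly_q ^ n"
  have n: "n > 0" by (simp add: n_def)
  \<comment> \<open>The test point \<open>q = 2\<close>, \<open>a = 1 / 2^n\<close> lies on the zero
    set of the modulus, so units are recognised by comparing powers of two.\<close>
  have unit: "loc_unit ?R (to_fract r)" if "poly (poly r [:1 / 2 ^ n:]) 2 \<noteq> 0" for r
    by (rule loc_unit_linear[where i = 0, OF degree_moduli(1)[OF n] _ _ that])
       (simp only: degree_moduli[OF n] dvd_refl, simp add: poly_poly_q_a)
  have one: "(2::rat) ^ k = 1 \<longleftrightarrow> k = 0" for k using power_of_2_inject[of k 0] by simp
  have u1: "loc_unit ?R (1 - ratfun_q ^ k)" if "k > 0" for k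
    unfolding to_fract_one_minus_power[symmetric] using that
    by (intro unit) (auto simp: poly_poly_q_a one dest: sym)
  \<comment> \<open>At the test point \<open>1 - a * q^(2 * d * i)\<close> vanishes only for
    \<open>n = 2 * d * i\<close>, which parity excludes.\<close>
  have odd: "n \<noteq> 2 * d * i" for i
  proof
    assume "n = 2 * d * i"
    then have "even n" by simp
    then show False by (simp add: n_def)
  qed
  show "quad_modulus ?R ratfun_q ratfun_a (ratfun_q ^ (d - 1)) m"
  proof (rule quad_modulusI(1))
    show "loc_unit ?R ratfun_q" "loc_unit ?R ratfun_a"
      unfolding ratfun_q_def ratfun_a_def by (auto intro!: unit simp: poly_poly_q_a)
    show "loc_unit ?R (1 - ratfun_a * ratfun_q ^ (2 * d * i))" for i
      unfolding to_fract_one_minus_power[symmetric]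
      using odd[of i] by (intro unit) (simp add: poly_poly_q_a field_simps power_of_2_inject)
    show "loc_unit ?R (ratfun_a - ratfun_q ^ (2 * d * i))" for i
      unfolding to_fract_one_minus_power[symmetric]
      by (intro unit) (auto simp: poly_poly_q_a field_simps power_add[symmetric] one n dest: sym)
    show "loc_unit ?R (1 - ratfun_q ^ (d * k))" if "0 < k" for k
      using assms(1) that by (intro u1) simp
    show "loc_unit ?R (1 - ratfun_q ^ (d * (2 * i + 1) + 2))" for i
      by (intro u1) simp
  qed (use assms(1) in simp)
  show "loc_unit ?R (1 - ratfun_q)" using u1[of 1] by simp
qed

lemma quad_modulus_a_minus_q:
  fixes d m :: nat
  assumes "d > 1"
  defines "n \<equiv> 2 * d * m + 1"
  shows "quad_modulus (poly_a - poly_q ^ n) ratfun_q (1 / ratfun_a) (ratfun_q ^ (d - 1)) m"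
    and "loc_unit (poly_a - poly_q ^ n) (1 - ratfun_q)"
    and "loc_unit (poly_a - poly_q ^ n) ratfun_a"
proof -
  let ?R = "poly_a - poly_q ^ n"
  have n: "n > 0" by (simp add: n_def)
  \<comment> \<open>Now the test point is \<open>q = 2\<close>, \<open>a = 2^n\<close>, and parity
    of \<open>n\<close> is needed for \<open>a - q^(2 * d * i)\<close> instead.\<close>
  have unit: "loc_unit ?R (to_fract r)" if "poly (poly r [:2 ^ n:]) 2 \<noteq> 0" for r
    by (rule loc_unit_linear[where i = 1, OF degree_moduli(2)[OF n] _ _ that])
       (simp only: degree_moduli[OF n] dvd_refl, simp add: poly_poly_q_a)
  have one: "(2::rat) ^ k = 1 \<longleftrightarrow> k = 0" for k using power_of_2_inject[of k 0] by simp
  have u1: "loc_unit ?R (1 - ratfun_q ^ k)" if "k > 0" for k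
    unfolding to_fract_one_minus_power[symmetric] using that
    by (intro unit) (auto simp: poly_poly_q_a one dest: sym)
  have odd: "n \<noteq> 2 * d * i" for i
  proof
    assume "n = 2 * d * i"
    then have "even n" by simp
    then show False by (simp add: n_def)
  qed
  show a: "loc_unit ?R ratfun_a"
    unfolding ratfun_a_def by (auto intro!: unit simp: poly_poly_q_a)
  show "quad_modulus ?R ratfun_q (1 / ratfun_a) (ratfun_q ^ (d - 1)) m"
  proof (rule quad_modulusI(2))
    show "loc_unit ?R ratfun_q"
      unfolding ratfun_q_def by (auto intro!: unit simp: poly_poly_q_a)
    show "loc_unit ?R (1 - ratfun_a * ratfun_q ^ (2 * d * i))" for i
      unfolding to_fract_one_minus_power[symmetric]
      by (intro unit) (auto simp: poly_poly_q_a power_add[symmetric] one n dest: sym)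
    show "loc_unit ?R (ratfun_a - ratfun_q ^ (2 * d * i))" for i
      unfolding to_fract_one_minus_power[symmetric]
      by (intro unit) (auto simp: poly_poly_q_a power_of_2_inject odd)
    show "loc_unit ?R (1 - ratfun_q ^ (d * k))" if "0 < k" for k
      using assms(1) that by (intro u1) simp
    show "loc_unit ?R (1 - ratfun_q ^ (d * (2 * i + 1) + 2))" for i
      by (intro u1) simp
  qed (use assms(1) a in simp_all)
  show "loc_unit ?R (1 - ratfun_q)" using u1[of 1] by simp
qed

text \<open>Factors in \<open>q\<close> alone are units when \<open>n\<close> does not divide their
  exponent; factors containing \<open>a\<close> have a coefficient \<open>1\<close> as polynomials
  in \<open>a\<close>.\<close>

lemma quad_modulus_cyclotomic:
  fixes d m :: nat
  assumes "d > 1" "m > 0"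
  defines "n \<equiv> 2 * d * m + 1"
  shows "quad_modulus [:cyclotomic n:] ratfun_q ratfun_a (ratfun_q ^ (d - 1)) m"
    and "loc_unit [:cyclotomic n:] (1 - ratfun_q)"
proof -
  let ?R = "[:cyclotomic n:]"
  have n: "n > 1" using assms by (simp add: n_def)
  then have n0: "n > 0" by simp
  have z: "cyclotomic n \<noteq> 0" using cyclotomic_nonzero[OF n0] .
  have u1: "loc_unit ?R (1 - ratfun_q ^ k)" if "\<not> n dvd k" for k
  proof -
    have "coprime (1 - monom 1 k) (cyclotomic n)"
    proof (rule coprime_cyclotomic[OF n0])
      fix z assume "z \<in> primitive_roots_unity n"
      then have "z ^ k \<noteq> 1" using primitive_roots_unity_power_eq_1[OF n0] that by blast
      then show "poly (of_rat_poly (1 - monom 1 k)) z \<noteq> 0"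
        by (simp add: of_rat_poly_diff map_poly_monom poly_monom)
    qed
    then have "coprime [:1 - monom 1 k:] ?R" using z by (rule coprime_const_poly)
    moreover have "1 - monom 1 k \<noteq> (0 :: rat poly)"
    proof
      assume "1 - monom 1 k = (0 :: rat poly)"
      then have "monom 1 k = (monom 1 0 :: rat poly)" by simp
      then have "k = 0" by (metis degree_monom_eq zero_neq_one)
      then show False using that by simp
    qed
    moreover have "1 - poly_q ^ k = [:1 - monom 1 k:]" by (simp add: poly_q_power one_pCons)
    ultimately show ?thesis
      unfolding to_fract_one_minus_power[symmetric] by (intro loc_unit_to_fract) simp_all
  qed
  have u2: "loc_unit ?R (to_fract r)" if "coeff r i = 1" for r i
  proof (rule loc_unit_to_fract)
    show "r \<noteq> 0" using that by auto
    show "coprime r ?R" using that z by (intro coprime_poly_const_poly[of _ i]) simp_all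
  qed
  show "quad_modulus ?R ratfun_q ratfun_a (ratfun_q ^ (d - 1)) m"
  proof (rule quad_modulusI(1))
    have "coprime [:0, 1:] (cyclotomic n)"
    proof (rule coprime_cyclotomic[OF n0])
      fix z assume "z \<in> primitive_roots_unity n"
      then have "z \<noteq> 0" using n0 by (auto simp: primitive_roots_unity_def power_0_left)
      then show "poly (of_rat_poly [:0, 1:]) z \<noteq> 0" by (simp add: map_poly_pCons)
    qed
    then show "loc_unit ?R ratfun_q"
      unfolding ratfun_q_def poly_q_def using z
      by (intro loc_unit_to_fract coprime_const_poly) simp_all
    show "loc_unit ?R ratfun_a"
      unfolding ratfun_a_def by (rule u2[of _ 1]) (simp add: poly_a_def)
    show "loc_unit ?R (1 - ratfun_a * ratfun_q ^ (2 * d * i))" if "0 < i" for i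
      unfolding to_fract_one_minus_power[symmetric]
      by (rule u2[of _ 0], rule degree_moduli(3)) (use assms that in simp)
    show "loc_unit ?R (ratfun_a - ratfun_q ^ (2 * d * i))" if "0 < i" for i
      unfolding to_fract_one_minus_power[symmetric]
      by (rule u2[of _ 1], rule degree_moduli(4)) (use assms that in simp)
    show "loc_unit ?R (1 - ratfun_q ^ (d * k))" if "0 < k" "k \<le> 2 * m" for k
    proof (rule u1)
      have "d * k \<le> d * (2 * m)" using that by (intro mult_left_mono) simp_all
      also have "\<dots> < n" unfolding n_def by simp
      finally have "d * k < n" .
      then show "\<not> n dvd d * k" using assms(1) that by (auto dest: dvd_imp_le)
    qed
    show "loc_unit ?R (1 - ratfun_q ^ (d * (2 * i + 1) + 2))" if "i \<le> 3 * m" for i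
      unfolding n_def by (rule u1[unfolded n_def]) (rule not_dvd_exponent[OF assms(1,2) that])
  qed (use assms(1) in simp)
  show "loc_unit ?R (1 - ratfun_q)" using u1[of 1] n by simp
qed

theorem theorem4:
  fixes d n :: nat and q a :: ratfun_qa
  assumes "d > 1" and "n > 1" and "[n = 1] (mod (2 * d))"
  defines "q \<equiv> ratfun_q" and "a \<equiv> ratfun_a"
  shows "ratfun_cong
    (\<Sum>k = 0..(n - 1) div d.
       qint q (3 * d * k + 1)
       * (qpoch q (q ^ (2 * d)) k * qpoch (q ^ (d - 1)) (q ^ d) k
          * (qpoch (a * q) (q ^ d) k * qpoch (q / a) (q ^ d) k))
       / (qpoch (q ^ d) (q ^ d) k * qpoch (q ^ (d + 2)) (q ^ (2 * d)) k
          * (qpoch (a * q ^ (2 * d)) (q ^ (2 * d)) k * qpoch (q ^ (2 * d) / a) (q ^ (2 * d)) k))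
       * q ^ (d * (k\<^sup>2 + k) div 2))
    (qpoch (q ^ d) (q ^ (2 * d)) ((n - 1) div (2 * d))
       / qpoch (q ^ (d + 2)) (q ^ (2 * d)) ((n - 1) div (2 * d))
       * qint q n
       * q powi (- int ((n - 1) * (d - 1) div (2 * d))))
    ([:cyclotomic n:] * (1 - poly_a * poly_q ^ n) * (poly_a - poly_q ^ n))"
    (is "ratfun_cong ?L ?R _")
proof -
  define m where "m = (n - 1) div (2 * d)"
  have "n mod (2 * d) = 1" using assms(1,3) by (simp add: cong_def)
  then have n: "n = 2 * d * m + 1"
    using mult_div_mod_eq[of "2 * d" n] by (metis add_diff_cancel_right' m_def minus_mod_eq_mult_div
        mult_div_mod_eq nonzero_mult_div_cancel_left mult_eq_0_iff mult_zero_left)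
  have m: "m > 0" using assms(2) n by (cases m) simp_all
  have d: "d > 0" using assms(1) by simp
  have n1: "(n - 1) div d = 2 * m" using n d by (simp add: mult_ac)
  have n2: "(n - 1) * (d - 1) div (2 * d) = m * (d - 1)" using n d by (simp add: mult.assoc)
  have q0: "q \<noteq> 0" by (simp add: q_def ratfun_q_def poly_q_def)
  have a0: "a \<noteq> 0" by (simp add: a_def ratfun_a_def poly_a_def)
  define e where "e = q ^ (d - 1)"
  define p where "p = q * e"
  define X where "X = (\<Sum>k\<le>2 * m. quad_term (q / a) (q * a) e p k)"
  define Y where "Y = qpoch p (p\<^sup>2) m / qpoch (q\<^sup>2 * p) (p\<^sup>2) m * (q / p) ^ m * (1 - q * p ^ (2 * m))"
  \<comment> \<open>Both sides carry the factor \<open>1 / (1 - q)\<close>, so it suffices to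
    compare \<open>X\<close> with \<open>Y\<close> wherever \<open>1 - q\<close> is a unit.\<close>
  have L: "?L = X / (1 - q)"
    unfolding summand_eq_quad_term[OF q0 a0 d] n1 X_def e_def p_def sum_divide_distrib atLeast0AtMost ..
  have R: "?R = Y / (1 - q)"
    unfolding m_def[symmetric] n2 Y_def e_def p_def
    by (subst n) (rule product_eq[OF q0 d])
  have X': "X = (\<Sum>k\<le>2 * m. quad_term (q / (1 / a)) (q * (1 / a)) e p k)"
    unfolding X_def by (subst quad_term_commute) simp
  have qn: "q * p ^ (2 * m) = q ^ n"
    using d by (cases d) (simp_all add: n p_def e_def power_mult[symmetric] power_Suc[symmetric] mult_ac
        del: power_Suc)
  \<comment> \<open>One statement for both linear factors: \<open>s\<close> will be \<open>a\<close>
    for \<open>?P2\<close> and \<open>1 / a\<close> for \<open>?P3\<close>.\<close>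
  have product: "ratfun_cong X Y P"
    if M: "quad_modulus P q s e m" and "ratfun_cong (1 - s * q * p ^ (2 * m)) 0 P"
      and X: "X = (\<Sum>k\<le>2 * m. quad_term (q / s) (q * s) e p k)" for P s
    using quad_modulus.S_0_cong_product[OF M] that(2)
    unfolding quad_modulus.S_def[OF M] quad_modulus.b_def[OF M] quad_modulus.c_def[OF M]
      quad_modulus.p_def[OF M] p_def[symmetric] Y_def X by simp
  have diff: "ratfun_cong (?L - ?R) 0 P" if "ratfun_cong X Y P" "loc_unit P (1 - q)" for P
    unfolding L R diff_divide_distrib[symmetric]
    using that by (intro ratfun_cong_0_divide iffD1[OF ratfun_cong_0_iff])
  let ?P1 = "[:cyclotomic n:]" and ?P2 = "1 - poly_a * poly_q ^ n" and ?P3 = "poly_a - poly_q ^ n"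
  have "ratfun_cong (?L - ?R) 0 ?P1"
  proof (rule diff)
    have M: "quad_modulus ?P1 q a e m"
      unfolding e_def q_def a_def n by (rule quad_modulus_cyclotomic(1)[OF assms(1) m])
    show "loc_unit ?P1 (1 - q)"
      unfolding q_def n by (rule quad_modulus_cyclotomic(2)[OF assms(1) m])
    have "?P1 dvd [:monom 1 n - 1:]"
      using cyclotomic_dvd[of n] n by (simp add: const_poly_dvd_const_poly_iff)
    then have "?P1 dvd - [:monom 1 n - 1:]" by (simp only: dvd_minus_iff)
    also have "- [:monom 1 n - 1:] = 1 - poly_q ^ n" by (simp add: poly_q_power one_pCons)
    finally have "ratfun_cong (1 - q * p ^ (2 * m)) 0 ?P1"
      unfolding qn unfolding q_def to_fract_one_minus_power[symmetric] by (rule ratfun_cong_0_dvd)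
    then have zero: "ratfun_cong (1 - q * p ^ (2 * m)) 0 ?P1" "ratfun_cong X 0 ?P1"
      using quad_modulus.S_0_cong_0[OF M]
      unfolding quad_modulus.S_def[OF M] quad_modulus.b_def[OF M] quad_modulus.c_def[OF M]
        quad_modulus.p_def[OF M] p_def[symmetric] X_def by simp_all
    have unit: "loc_unit ?P1 q" "loc_unit ?P1 p" "loc_unit ?P1 (qpoch (q\<^sup>2 * p) (p\<^sup>2) m)"
      using quad_modulus.q[OF M] quad_modulus.p[OF M] quad_modulus.units(4)[OF M, of 0 m]
      unfolding quad_modulus.parameters[OF M] unfolding quad_modulus.p_def[OF M] p_def[symmetric] by simp_all
    \<comment> \<open>Both sides vanish here: \<open>Y\<close> contains
      \<open>1 - q * p^(2 * m)\<close>, which is \<open>1 - q^n\<close>.\<close>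
    have "ratfun_cong Y 0 ?P1"
      unfolding Y_def using zero(1) unit
      by (intro ratfun_cong_0_mult_left loc_mult loc_divide loc_power loc_qpoch loc_unitD(1))
    then show "ratfun_cong X Y ?P1" using ratfun_cong_trans[OF zero(2) ratfun_cong_sym] by blast
  qed
  moreover have "ratfun_cong (?L - ?R) 0 ?P2"
  proof (rule diff[OF product])
    show "quad_modulus ?P2 q a e m"
      unfolding e_def q_def a_def n by (rule quad_modulus_1_minus_aq(1)[OF assms(1)])
    show "loc_unit ?P2 (1 - q)"
      unfolding q_def n by (rule quad_modulus_1_minus_aq(2)[OF assms(1)])
    have "1 - a * q * p ^ (2 * m) = to_fract ?P2"
      unfolding to_fract_one_minus_power mult.assoc qn by (simp only: a_def q_def)
    then show "ratfun_cong (1 - a * q * p ^ (2 * m)) 0 ?P2"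
      by (simp only: ratfun_cong_0_dvd dvd_refl)
  qed (fact X_def)
  moreover have "ratfun_cong (?L - ?R) 0 ?P3"
  proof (rule diff[OF product])
    show "quad_modulus ?P3 q (1 / a) e m"
      unfolding e_def q_def a_def n by (rule quad_modulus_a_minus_q(1)[OF assms(1)])
    show "loc_unit ?P3 (1 - q)"
      unfolding q_def n by (rule quad_modulus_a_minus_q(2)[OF assms(1)])
    have a: "loc_unit ?P3 a"
      unfolding a_def n by (rule quad_modulus_a_minus_q(3)[OF assms(1)])
    have "1 - 1 / a * q * p ^ (2 * m) = to_fract ?P3 / a"
      unfolding to_fract_one_minus_power mult.assoc qn a_def[symmetric] q_def[symmetric]
      using a0 by (simp add: field_simps)
    then show "ratfun_cong (1 - 1 / a * q * p ^ (2 * m)) 0 ?P3"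
      using a by (simp only: ratfun_cong_0_divide ratfun_cong_0_dvd dvd_refl)
  qed (fact X')
  moreover have "coprime ?P1 ?P2" "coprime (?P1 * ?P2) ?P3"
  proof -
    have n0: "n > 0" "cyclotomic n \<noteq> 0" using n by (simp_all add: cyclotomic_nonzero)
    have "coprime ?P2 ?P1"
      by (rule coprime_poly_const_poly[of _ 0]) (simp_all only: degree_moduli n0 dvd_refl not_False_eq_True)
    moreover have "coprime ?P3 ?P1"
      by (rule coprime_poly_const_poly[of _ 1]) (simp_all only: degree_moduli n0 dvd_refl not_False_eq_True)
    moreover have "coprime ?P2 ?P3"
    \<comment> \<open>At \<open>q = 2\<close>, \<open>a = 2^n\<close> the factor \<open>?P3\<close>
      vanishes while \<open>?P2\<close> equals \<open>1 - 2^(2 * n)\<close>.\<close>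
    proof (rule coprime_linear[OF degree_moduli(2)[OF n0(1)]])
      show "is_unit (coeff ?P3 1)" by (simp only: degree_moduli n0 dvd_refl)
      show "poly (poly ?P3 [:2 ^ n:]) 2 = 0" by (simp add: poly_poly_q_a)
      show "poly (poly ?P2 [:2 ^ n:]) 2 \<noteq> 0"
        using power_of_2_inject[of 0 "n + n"] n0 by (simp add: poly_poly_q_a power_add)
    qed
    ultimately show "coprime ?P1 ?P2" "coprime (?P1 * ?P2) ?P3"
      by (simp_all only: coprime_commute coprime_mult_right_iff)
  qed
  ultimately have "ratfun_cong (?L - ?R) 0 (?P1 * ?P2 * ?P3)"
    by (intro ratfun_cong_0_coprime_mult)
  then show ?thesis by (rule iffD2[OF ratfun_cong_0_iff])
qed

end
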